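(* The algebra $H^\infty(\mathbb D)$ has the following bounded detection envelopes. Let $S_r$ be the truncated shift on $\mathbb C^{r+1}$: $S_re_j=e_{j+1}$ for $0\le j<r$, and $S_re_r=0$, where $(e_j)_{j=0}^r$ is the standard basis. (i) For the Taylor filtration $I_r=z^{r+1}H^\infty$, the quotient is the algebra of analytic Toeplitz matrices $$\Bigl\{\sum_{j=0}^ra_jS_r^j:\ a_0,\ldots,a_r\in\mathbb C\Bigr\},$$ with its operator norm. (ii) If $(\lambda_n)\subseteq\mathbb D$ is pairwise distinct and has an accumulation point in $\mathbb D$, and $$I_r=\{f\in H^\infty: f(\lambda_0)=\cdots=f(\lambda_r)=0\},$$ then $H^\infty/I_r$ is the finite interpolation algebra whose norm is determined, for every $C\ge0$, by $$\|(w_i)\|\le C\iff\left[\frac{C^2-w_i\overline{w_j}}{1-\lambda_i\overline{\lambda_j}}\right]_{i,j=0}^r\succeq0.$$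
   Context: $H^\infty=H^\infty(\mathbb D)$ is the Banach algebra of bounded analytic functions on the open unit disc $\mathbb D$, with pointwise multiplication and the supremum norm. The index $r$ runs over $\mathbb N=\{0,1,2,\ldots\}$, and $(\lambda_n)$ is indexed by $n\in\mathbb N$. Operator norms are taken with respect to the Euclidean norm on $\mathbb C^{r+1}$, and $\succeq0$ means positive semidefinite. The finite interpolation algebra in (ii) is the algebra of value tuples $(w_i)_{i=0}^r=(f(\lambda_i))_{i=0}^r$, $f\in H^\infty$, with coordinatewise multiplication. For a unital Banach algebra $A$ with $\|1_A\|=1$ and a decreasing sequence $(I_r)_{r\in\mathbb N}$ (a filtration) of proper closed two-sided ideals of finite codimension, each $A/I_r$ carries its quotient norm, and for $r\le s$ let $\pi_r^s:A/I_s\to A/I_r$ be the canonical map $a+I_s\mapsto a+I_r$. The bounded detection envelope of $(A,(I_r))$ is the algebra of all sequences $(a_r)_r$ with $a_r\in A/I_r$, $\pi_r^sa_s=a_r$ for $r\le s$, and $\sup_r\|a_r\|<\infty$, with coordinatewise multiplication and norm $\sup_r\|a_r\|$. *)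

theory Defs
  imports
    "HOL-Complex_Analysis.Complex_Analysis"
    "HOL-Algebra.QuotRing"
    "HOL-Algebra.Module"
    "Jordan_Normal_Form.Matrix"
begin

section \<open>Complex Banach algebras with explicit carriers\<close>

definition complex_ring :: "complex ring" where
  "complex_ring = \<lparr>carrier = UNIV, monoid.mult = (*), one = 1, zero = 0, add = (+)\<rparr>"

record 'a normed_algebra = "(complex, 'a) module" +
  anorm :: "'a \<Rightarrow> real"

text \<open>The value outside the carrier is irrelevant; it is 0 because the locale
  \<^locale>\<open>Metric_space\<close> wants nonnegativity and symmetry on the whole type.\<close>

definition adist :: "('a, 'b) normed_algebra_scheme \<Rightarrow> 'a \<Rightarrow> 'a \<Rightarrow> real" where
  "adist A x y =
     (if x \<in> carrier A \<and> y \<in> carrier A then anorm A (x \<ominus>\<^bsub>A\<^esub> y) else 0)"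

locale unital_banach_algebra = ring A + module complex_ring A
  for A :: "('a, 'b) normed_algebra_scheme" (structure) +
  assumes smult_mult_left:
      "\<lbrakk>x \<in> carrier A; y \<in> carrier A\<rbrakk> \<Longrightarrow> (c \<odot> x) \<otimes> y = c \<odot> (x \<otimes> y)"
    and smult_mult_right:
      "\<lbrakk>x \<in> carrier A; y \<in> carrier A\<rbrakk> \<Longrightarrow> x \<otimes> (c \<odot> y) = c \<odot> (x \<otimes> y)"
    and anorm_nonneg: "x \<in> carrier A \<Longrightarrow> 0 \<le> anorm A x"
    and anorm_eq_0_iff: "x \<in> carrier A \<Longrightarrow> anorm A x = 0 \<longleftrightarrow> x = \<zero>"
    and anorm_triangle:
      "\<lbrakk>x \<in> carrier A; y \<in> carrier A\<rbrakk> \<Longrightarrow> anorm A (x \<oplus> y) \<le> anorm A x + anorm A y"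
    and anorm_smult: "x \<in> carrier A \<Longrightarrow> anorm A (c \<odot> x) = cmod c * anorm A x"
    and anorm_mult:
      "\<lbrakk>x \<in> carrier A; y \<in> carrier A\<rbrakk> \<Longrightarrow> anorm A (x \<otimes> y) \<le> anorm A x * anorm A y"
    and anorm_one: "anorm A \<one> = 1"
    and complete: "Metric_space.mcomplete (carrier A) (adist A)"

text \<open>Isometric isomorphisms of unital complex normed algebras.\<close>

definition isometric_iso ::
  "('a, 'c) normed_algebra_scheme \<Rightarrow> ('b, 'd) normed_algebra_scheme \<Rightarrow> ('a \<Rightarrow> 'b) set" where
  "isometric_iso A B = {h \<in> ring_iso A B.
     (\<forall>c. \<forall>x\<in>carrier A. h (c \<odot>\<^bsub>A\<^esub> x) = c \<odot>\<^bsub>B\<^esub> h x) \<and>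
     (\<forall>x\<in>carrier A. anorm B (h x) = anorm A x)}"

section \<open>Bounded detection envelopes\<close>

definition quotient_algebra ::
  "('a, 'b) normed_algebra_scheme \<Rightarrow> 'a set \<Rightarrow> 'a set normed_algebra" where
  "quotient_algebra A I =
     \<lparr>carrier = carrier (A Quot I), monoid.mult = monoid.mult (A Quot I), one = one (A Quot I),
      zero = zero (A Quot I), add = add (A Quot I),
      smult = (\<lambda>c X. \<Union>x\<in>X. I +>\<^bsub>A\<^esub> (c \<odot>\<^bsub>A\<^esub> x)),
      anorm = (\<lambda>X. INF x\<in>X. anorm A x)\<rparr>"

text \<open>For an ideal \<open>J \<subseteq> I\<close> this sends \<open>J + a\<close> to \<open>I + a\<close>
  (lemma \<open>quotient_proj_coset\<close>); \<open>J\<close> need not be mentioned.\<close>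

definition quotient_proj :: "('a, 'b) normed_algebra_scheme \<Rightarrow> 'a set \<Rightarrow> 'a set \<Rightarrow> 'a set" where
  "quotient_proj A I X = (\<Union>x\<in>X. I +>\<^bsub>A\<^esub> x)"

lemma quotient_proj_coset:
  assumes "ideal I A" "ideal J A" "J \<subseteq> I" "a \<in> carrier A"
  shows "quotient_proj A I (J +>\<^bsub>A\<^esub> a) = I +>\<^bsub>A\<^esub> a"
proof -
  interpret I: ideal I A by fact
  interpret J: ideal J A by fact
  have "I +>\<^bsub>A\<^esub> x = I +>\<^bsub>A\<^esub> a" if x: "x \<in> J +>\<^bsub>A\<^esub> a" for x
  proof -
    have "x \<in> I +>\<^bsub>A\<^esub> a"
      using x assms(3) by (auto simp: a_r_coset_def')
    then show ?thesis
      using I.a_repr_independence[OF _ assms(4) I.is_additive_subgroup[THEN additive_subgroup.a_subgroup]] by simp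
  qed
  moreover have "J +>\<^bsub>A\<^esub> a \<noteq> {}"
    using J.a_rcos_self[OF assms(4)] by blast
  ultimately show ?thesis
    by (auto simp: quotient_proj_def)
qed

locale detection_filtration = unital_banach_algebra A
  for A :: "('a, 'b) normed_algebra_scheme" (structure) +
  fixes I :: "nat \<Rightarrow> 'a set"
  assumes two_sided_ideal: "ideal (I r) A"
    and proper: "I r \<noteq> carrier A"
    and closed_ideal: "closedin (Metric_space.mtopology (carrier A) (adist A)) (I r)"
    and finite_codimension:
      "\<exists>B. finite B \<and> B \<subseteq> carrier A \<and>
         (\<forall>x\<in>carrier A. \<exists>c. x \<ominus> (\<Oplus>b\<in>B. c b \<odot> b) \<in> I r)"
    and decreasing: "r \<le> s \<Longrightarrow> I s \<subseteq> I r"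

text \<open>The algebra of bounded compatible sequences in a tower of normed algebras \<open>B r\<close>;
  for all \<open>r \<le> s\<close> the same function \<open>p r\<close> serves as connecting map from \<open>B s\<close> to \<open>B r\<close>.\<close>

definition bounded_limit ::
  "(nat \<Rightarrow> ('a, 'b) normed_algebra_scheme) \<Rightarrow> (nat \<Rightarrow> 'a \<Rightarrow> 'a) \<Rightarrow> (nat \<Rightarrow> 'a) normed_algebra"
where
  "bounded_limit B p =
     \<lparr>carrier = {a. (\<forall>r. a r \<in> carrier (B r)) \<and> (\<forall>r s. r \<le> s \<longrightarrow> p r (a s) = a r) \<and>
        bdd_above (range (\<lambda>r. anorm (B r) (a r)))},
      monoid.mult = (\<lambda>a b r. a r \<otimes>\<^bsub>B r\<^esub> b r), one = (\<lambda>r. \<one>\<^bsub>B r\<^esub>),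
      zero = (\<lambda>r. \<zero>\<^bsub>B r\<^esub>), add = (\<lambda>a b r. a r \<oplus>\<^bsub>B r\<^esub> b r),
      smult = (\<lambda>c a r. c \<odot>\<^bsub>B r\<^esub> a r),
      anorm = (\<lambda>a. SUP r. anorm (B r) (a r))\<rparr>"

definition detection_envelope ::
  "('a, 'b) normed_algebra_scheme \<Rightarrow> (nat \<Rightarrow> 'a set) \<Rightarrow> (nat \<Rightarrow> 'a set) normed_algebra" where
  "detection_envelope A I =
     bounded_limit (\<lambda>r. quotient_algebra A (I r)) (\<lambda>r. quotient_proj A (I r))"

section \<open>Bounded analytic functions on the unit disc\<close>

abbreviation disc :: "complex set" where
  "disc \<equiv> ball 0 1"

text \<open>Functions on the disc are HOL functions that are \<^const>\<open>undefined\<close> outside it.\<close>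

definition H_infinity :: "(complex \<Rightarrow> complex) normed_algebra" where
  "H_infinity =
     \<lparr>carrier = {f \<in> extensional disc. f holomorphic_on disc \<and> bounded (f ` disc)},
      monoid.mult = (\<lambda>f g. \<lambda>z\<in>disc. f z * g z), one = (\<lambda>z\<in>disc. 1),
      zero = (\<lambda>z\<in>disc. 0), add = (\<lambda>f g. \<lambda>z\<in>disc. f z + g z),
      smult = (\<lambda>c f. \<lambda>z\<in>disc. c * f z),
      anorm = (\<lambda>f. SUP z\<in>disc. cmod (f z))\<rparr>"

definition taylor_ideal :: "nat \<Rightarrow> (complex \<Rightarrow> complex) set" where
  "taylor_ideal r = {\<lambda>z\<in>disc. z ^ Suc r * g z | g. g \<in> carrier H_infinity}"

definition taylor_coeff :: "(complex \<Rightarrow> complex) \<Rightarrow> nat \<Rightarrow> complex" where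
  "taylor_coeff f j = (deriv ^^ j) f 0 / fact j"

definition vanishing_ideal :: "(nat \<Rightarrow> complex) \<Rightarrow> nat \<Rightarrow> (complex \<Rightarrow> complex) set" where
  "vanishing_ideal l r = {f \<in> carrier H_infinity. \<forall>i\<le>r. f (l i) = 0}"

section \<open>Matrices, Toeplitz algebras and interpolation algebras\<close>

definition euclidean_norm :: "complex Matrix.vec \<Rightarrow> real" where
  "euclidean_norm v = L2_set (\<lambda>i. cmod (vec_index v i)) {..<dim_vec v}"

definition operator_norm :: "complex mat \<Rightarrow> real" where
  "operator_norm T =
     (SUP v\<in>{v \<in> carrier_vec (dim_col T). euclidean_norm v \<le> 1}. euclidean_norm (T *\<^sub>v v))"

text \<open>The order on \<^typ>\<open>complex\<close> makes \<open>0 \<le> z\<close> say that \<open>z\<close> is real and nonnegative;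
  in particular these matrices are Hermitian.\<close>

definition positive_semidefinite :: "complex mat \<Rightarrow> bool" where
  "positive_semidefinite P \<longleftrightarrow>
     square_mat P \<and> (\<forall>v\<in>carrier_vec (dim_row P). 0 \<le> (P *\<^sub>v v) \<bullet>c v)"

definition truncated_shift :: "nat \<Rightarrow> complex mat" where
  "truncated_shift r = Matrix.mat (Suc r) (Suc r) (\<lambda>(i, j). if i = Suc j then 1 else 0)"

definition toeplitz :: "nat \<Rightarrow> (nat \<Rightarrow> complex) \<Rightarrow> complex mat" where
  "toeplitz r a =
     (\<Oplus>\<^bsub>ring_mat TYPE(complex) (Suc r) ()\<^esub> j\<in>{..r}. a j \<cdot>\<^sub>m (truncated_shift r ^\<^sub>m j))"

definition toeplitz_algebra :: "nat \<Rightarrow> complex mat normed_algebra" where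
  "toeplitz_algebra r =
     \<lparr>carrier = range (toeplitz r), monoid.mult = (*), one = 1\<^sub>m (Suc r),
      zero = 0\<^sub>m (Suc r) (Suc r), add = (+), smult = (\<cdot>\<^sub>m), anorm = operator_norm\<rparr>"

definition leading_block :: "nat \<Rightarrow> complex mat \<Rightarrow> complex mat" where
  "leading_block r T = Matrix.mat (Suc r) (Suc r) (\<lambda>(i, j). T $$ (i, j))"

definition value_tuple :: "(nat \<Rightarrow> complex) \<Rightarrow> nat \<Rightarrow> (complex \<Rightarrow> complex) \<Rightarrow> complex Matrix.vec" where
  "value_tuple l r f = Matrix.vec (Suc r) (\<lambda>i. f (l i))"

definition pick_matrix ::
  "(nat \<Rightarrow> complex) \<Rightarrow> nat \<Rightarrow> real \<Rightarrow> complex Matrix.vec \<Rightarrow> complex mat" where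
  "pick_matrix l r C w = Matrix.mat (Suc r) (Suc r)
     (\<lambda>(i, j). ((of_real C)\<^sup>2 - vec_index w i * cnj (vec_index w j)) / (1 - l i * cnj (l j)))"

text \<open>The norm is the least \<open>C \<ge> 0\<close> with positive semidefinite Pick matrix. That the set of
  these \<open>C\<close> is exactly the half-line from the norm on is part of what has to be proved.\<close>

definition interpolation_algebra ::
  "(nat \<Rightarrow> complex) \<Rightarrow> nat \<Rightarrow> complex Matrix.vec normed_algebra" where
  "interpolation_algebra l r =
     \<lparr>carrier = value_tuple l r ` carrier H_infinity,
      monoid.mult = (\<lambda>v w. Matrix.vec (Suc r) (\<lambda>i. vec_index v i * vec_index w i)),
      one = Matrix.vec (Suc r) (\<lambda>_. 1), zero = 0\<^sub>v (Suc r), add = (+), smult = (\<cdot>\<^sub>v),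
      anorm = (\<lambda>w. Inf {C. 0 \<le> C \<and> positive_semidefinite (pick_matrix l r C w)})\<rparr>"

definition leading_entries :: "nat \<Rightarrow> complex Matrix.vec \<Rightarrow> complex Matrix.vec" where
  "leading_entries r w = Matrix.vec (Suc r) (vec_index w)"

end

theory Submission
  imports Defs
begin

text \<open>
  Both quotient norms come from one step of Schur's algorithm. If \<open>f\<close> maps the disc to the closed
  disc and \<open>c = f p\<close> has modulus less than 1, then by the Schwarz lemma
  \<open>(f - c) / (1 - cnj c * f) = (z - p) / (1 - cnj p * z) * g\<close> for a \<open>g\<close> of the same kind, and every
  such \<open>g\<close> arises; if \<open>c\<close> has modulus 1, then \<open>f\<close> is constant. For interpolation at distinct points
  the step from \<open>f\<close> to \<open>g\<close> is a Schur complement in the Pick matrix. For prescribed Taylor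
  coefficients (\<open>p = 0\<close>) it is a Moebius transformation of the truncated Toeplitz operator, which
  preserves contractions, followed by the removal of a zero row and column. Induction on the
  number of conditions gives the theorems of Nevanlinna--Pick and Caratheodory--Schur. They say that
  the infimum defining the quotient norm is attained and equals the norm of the matrix or tuple;
  passing to bounded inverse limits is then formal.
\<close>

section \<open>Schur functions\<close>

text \<open>The step divides by \<open>1 - cnj c * f\<close>, which vanishes at \<open>p\<close>
  when \<open>c\<close> is unimodular. This boundary case has to be settled on both sides of each
  equivalence: the maximum principle makes the function constant, and positivity or contractivity
  has to force the same rigidity on the data. In return the theorems hold for closed balls without a
  limit argument, and this is what makes the quotient infimum attained. Toeplitz matrices are
  handled as multiplication by formal power series modulo \<open>fps_X ^ n\<close>: there the
  denominators are units, and the Moebius transformation of an operator is plain ring arithmetic.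
  Bounds other than 1 come from scaling, except the bound 0, which is done by hand. Both kinds of
  ideals are joint kernels of contractive functionals that have a dual family in
  \<open>H_infinity\<close>, so one lemma gives the filtration axioms for both. For the Pick norm,
  the least admissible \<open>C\<close> exists because positivity is a closed condition on
  \<open>C\<close>; that every larger \<open>C\<close> is admissible is seen on functions rather
  than on matrices.\<close>

definition schur_class :: "(complex \<Rightarrow> complex) set" where
  "schur_class = {f. f holomorphic_on disc \<and> (\<forall>z\<in>disc. cmod (f z) \<le> 1)}"

text \<open>Divided by the first square, this computes one minus the squared modulus of the Moebius
  map, so that map sends the closed disc into itself. The identity returns in polarised form for
  kernels and in homogeneous form for coefficient vectors.\<close>

lemma Moebius_identity:
  "(cmod (1 - cnj a * z))\<^sup>2 - (cmod (z - a))\<^sup>2 = (1 - (cmod a)\<^sup>2) * (1 - (cmod z)\<^sup>2)"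
  unfolding cmod_power2 by (simp add: algebra_simps power2_eq_square)

lemma one_minus_cnj_mult_neq_0:
  assumes "cmod a < 1" "cmod z \<le> 1"
  shows "1 - cnj a * z \<noteq> 0"
proof
  assume "1 - cnj a * z = 0"
  then have "cmod (cnj a * z) = 1" by (metis eq_iff_diff_eq_0 norm_one)
  moreover have "cmod a * cmod z \<le> cmod a * 1" using assms by (intro mult_left_mono) auto
  ultimately show False using assms by (simp add: norm_mult)
qed

text \<open>Stated up to the boundary because a Schur function may take values of modulus 1.\<close>

lemma Moebius_function_norm_le_1:
  assumes "cmod a < 1" "cmod z \<le> 1"
  shows "cmod (Moebius_function 0 a z) \<le> 1"
proof -
  have "0 \<le> (1 - (cmod a)\<^sup>2) * (1 - (cmod z)\<^sup>2)"
    using assms by (intro mult_nonneg_nonneg) (simp_all add: power_le_one)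
  then have "(cmod (z - a))\<^sup>2 \<le> (cmod (1 - cnj a * z))\<^sup>2"
    using Moebius_identity[of a z] by linarith
  then have "cmod (z - a) \<le> cmod (1 - cnj a * z)"
    by (rule power2_le_imp_le) (rule norm_ge_zero)
  then show ?thesis
    using one_minus_cnj_mult_neq_0[OF assms]
    by (simp add: Moebius_function_simple norm_divide divide_le_eq)
qed

lemma schur_class_Moebius:
  assumes "f \<in> schur_class" "cmod a < 1"
  shows "(\<lambda>z. Moebius_function 0 a (f z)) \<in> schur_class"
proof -
  have "(\<lambda>z. (f z - a) / (1 - cnj a * f z)) holomorphic_on disc"
    using assms one_minus_cnj_mult_neq_0[OF assms(2)]
    by (intro holomorphic_intros) (auto simp: schur_class_def)
  then show ?thesis
    using assms Moebius_function_norm_le_1[OF assms(2)]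
    by (auto simp: schur_class_def Moebius_function_simple)
qed

lemma schur_class_compose_Moebius:
  assumes "f \<in> schur_class" "cmod a < 1"
  shows "(\<lambda>z. f (Moebius_function 0 a z)) \<in> schur_class"
proof -
  have M: "Moebius_function 0 a ` disc \<subseteq> disc"
    using Moebius_function_norm_lt_1[OF assms(2)] by auto
  have "(f \<circ> Moebius_function 0 a) holomorphic_on disc"
    using assms by (intro holomorphic_on_compose_gen[OF Moebius_function_holomorphic[OF assms(2)] _ M])
      (auto simp: schur_class_def)
  then show ?thesis
    using assms M unfolding schur_class_def comp_def by blast
qed

text \<open>The modulus attains its maximum 1 at the interior point \<open>p\<close>, so the maximum
  modulus principle applies. This covers the case in which the Schur step would divide by
  zero.\<close>

lemma schur_class_unimodular:
  assumes "f \<in> schur_class" "p \<in> disc" "z \<in> disc" "cmod (f p) = 1"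
  shows "f z = f p"
proof -
  have "f constant_on disc"
    using assms
    by (intro maximum_modulus_principle[where U = disc and \<xi> = p]) (auto simp: schur_class_def)
  then show ?thesis using assms by (auto simp: constant_on_def)
qed

lemma schur_class_divide_ident:
  assumes f: "f \<in> schur_class" and 0: "f 0 = 0"
  obtains g where "g \<in> schur_class" "\<And>z. z \<in> disc \<Longrightarrow> f z = z * g z"
proof -
  have hol: "f holomorphic_on disc" using f by (simp add: schur_class_def)
  \<comment> \<open>The Schwarz lemma wants a strict bound. Modulus 1 at an interior point would
    make \<open>f\<close> constant, against \<open>f 0 = 0\<close>.\<close>
  have lt: "cmod (f z) < 1" if "cmod z < 1" for z
  proof (rule ccontr)
    assume "\<not> cmod (f z) < 1"
    then have "cmod (f z) = 1" using f that by (force simp: schur_class_def)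
    then have "f 0 = f z" using schur_class_unimodular[OF f, of z 0] that by simp
    then show False using 0 \<open>cmod (f z) = 1\<close> by simp
  qed
  obtain g where g: "g holomorphic_on disc" "\<And>z. cmod z < 1 \<Longrightarrow> f z = z * g z" "deriv f 0 = g 0"
    using Schwarz3[OF hol 0] by auto
  have "cmod (g z) \<le> 1" if z: "z \<in> disc" for z
  proof (cases "z = 0")
    case True
    then show ?thesis
      using Schwarz_Lemma(2)[OF hol 0 lt, of 0] g(3) by simp
  next
    case False
    then show ?thesis
      using Schwarz_Lemma(1)[OF hol 0 lt, of z] g(2)[of z] z
      by (simp add: norm_mult field_simps mult_le_cancel_left1)
  qed
  with g have "g \<in> schur_class" by (simp add: schur_class_def)
  with g(2) show thesis by (intro that) auto
qed

lemma Moebius_function_inverse: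
  assumes "cmod a < 1" "cmod z \<le> 1"
  shows "Moebius_function 0 a (Moebius_function 0 (- a) z) = z"
proof -
  have "1 + cnj a * z \<noteq> 0" using one_minus_cnj_mult_neq_0[of "- a" z] assms by simp
  moreover have "1 - cnj a * a \<noteq> 0" using one_minus_cnj_mult_neq_0[of a a] assms by simp
  ultimately show ?thesis
    by (simp add: Moebius_function_simple divide_simps) (simp add: algebra_simps)
qed

text \<open>Moebius maps in the domain and in the range move \<open>p\<close> and \<open>f p\<close>
  to the origin. There the Schwarz lemma divides out the zero, and the quotient is carried back to
  the original coordinate.\<close>

lemma schur_reduce:
  assumes f: "f \<in> schur_class" and p: "p \<in> disc" and lt: "cmod (f p) < 1"
  obtains g where "g \<in> schur_class"
    "\<And>z. z \<in> disc \<Longrightarrow> Moebius_function 0 (f p) (f z) = Moebius_function 0 p z * g z"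
proof -
  have p': "cmod p < 1" "cmod (- p) < 1" using p by auto
  define F where "F = (\<lambda>z. Moebius_function 0 (f p) (f (Moebius_function 0 (- p) z)))"
  have "F \<in> schur_class"
    unfolding F_def
    by (intro schur_class_Moebius[OF schur_class_compose_Moebius[OF f p'(2)]] lt)
  moreover have "F 0 = 0" by (simp add: F_def Moebius_function_of_zero Moebius_function_eq_zero)
  ultimately obtain g where g: "g \<in> schur_class" "\<And>z. z \<in> disc \<Longrightarrow> F z = z * g z"
    using schur_class_divide_ident by blast
  show thesis
  proof
    show "(\<lambda>z. g (Moebius_function 0 p z)) \<in> schur_class"
      by (rule schur_class_compose_Moebius[OF g(1) p'(1)])
    fix z assume z: "z \<in> disc"
    then have "Moebius_function 0 p z \<in> disc" using Moebius_function_norm_lt_1[OF p'(1)] by simp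
    from g(2)[OF this] show "Moebius_function 0 (f p) (f z) =
        Moebius_function 0 p z * g (Moebius_function 0 p z)"
      using Moebius_function_inverse[OF p'(2), of z] z by (simp add: F_def)
  qed
qed

text \<open>Inverse of \<open>schur_reduce\<close>: the product on the right is a Schur function
  with a zero at \<open>p\<close>, and the inverse Moebius map in the range turns that zero into the
  value \<open>c\<close>.\<close>

lemma schur_extend:
  assumes g: "g \<in> schur_class" and p: "p \<in> disc" and c: "cmod c < 1"
  obtains f where "f \<in> schur_class" "f p = c"
    "\<And>z. z \<in> disc \<Longrightarrow> Moebius_function 0 c (f z) = Moebius_function 0 p z * g z"
proof -
  have p': "cmod p < 1" using p by auto
  define h where "h = (\<lambda>z. Moebius_function 0 p z * g z)"
  have h: "h \<in> schur_class"
    unfolding schur_class_def h_def mem_Collect_eq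
  proof (intro conjI ballI holomorphic_intros)
    show "g holomorphic_on disc" using g by (simp add: schur_class_def)
    show "Moebius_function 0 p holomorphic_on disc"
      by (rule Moebius_function_holomorphic[OF p'])
    fix z :: complex assume z: "z \<in> disc"
    have "cmod (Moebius_function 0 p z) * cmod (g z) \<le> 1 * 1"
      using Moebius_function_norm_le_1[OF p', of z] z g by (intro mult_mono) (auto simp: schur_class_def)
    then show "cmod (Moebius_function 0 p z * g z) \<le> 1" by (simp add: norm_mult)
  qed
  have c': "cmod (- c) < 1" using c by simp
  show thesis
  proof
    show "(\<lambda>z. Moebius_function 0 (- c) (h z)) \<in> schur_class"
      by (rule schur_class_Moebius[OF h c'])
    show "Moebius_function 0 (- c) (h p) = c"
      by (simp add: h_def Moebius_function_of_zero Moebius_function_eq_zero)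
    show "Moebius_function 0 c (Moebius_function 0 (- c) (h z)) = Moebius_function 0 p z * g z"
      if "z \<in> disc" for z
      using Moebius_function_inverse[OF c, of "h z"] that h by (auto simp: schur_class_def h_def)
  qed
qed

section \<open>Nevanlinna--Pick interpolation\<close>

text \<open>Indexed by a set instead of matrix positions, so that an induction can remove one node
  without renumbering the others.\<close>

definition psd_on :: "'i set \<Rightarrow> ('i \<Rightarrow> 'i \<Rightarrow> complex) \<Rightarrow> bool" where
  "psd_on J P \<longleftrightarrow> (\<forall>c. 0 \<le> (\<Sum>i\<in>J. \<Sum>j\<in>J. c i * cnj (c j) * P i j))"

lemma psd_on_cong:
  assumes "\<And>i j. i \<in> J \<Longrightarrow> j \<in> J \<Longrightarrow> P i j = Q i j"
  shows "psd_on J P \<longleftrightarrow> psd_on J Q"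
  unfolding psd_on_def using assms by (simp cong: sum.cong)

lemma psd_on_subset:
  assumes "psd_on J P" "finite J" "K \<subseteq> J"
  shows "psd_on K P"
  unfolding psd_on_def
proof
  fix c :: "_ \<Rightarrow> complex"
  define d where "d i = (if i \<in> K then c i else 0)" for i
  have "(\<Sum>i\<in>J. \<Sum>j\<in>J. d i * cnj (d j) * P i j) = (\<Sum>i\<in>K. \<Sum>j\<in>J. d i * cnj (d j) * P i j)"
    using assms by (intro sum.mono_neutral_right) (auto simp: d_def)
  also have "\<dots> = (\<Sum>i\<in>K. \<Sum>j\<in>K. d i * cnj (d j) * P i j)"
    using assms by (intro sum.cong[OF refl], intro sum.mono_neutral_right) (auto simp: d_def)
  also have "\<dots> = (\<Sum>i\<in>K. \<Sum>j\<in>K. c i * cnj (c j) * P i j)"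
    by (intro sum.cong refl) (auto simp: d_def)
  finally show "0 \<le> (\<Sum>i\<in>K. \<Sum>j\<in>K. c i * cnj (c j) * P i j)"
    using spec[OF assms(1)[unfolded psd_on_def], of d] by simp
qed

lemma psd_on_diagonal:
  assumes "psd_on J P" "finite J" "i \<in> J"
  shows "0 \<le> P i i"
  using psd_on_subset[OF assms(1,2), of "{i}"] assms(3)
  by (auto simp: psd_on_def dest: spec[of _ "\<lambda>_. 1"])

text \<open>Restricted to the two indices \<open>k\<close> and \<open>i\<close>, the form is affine
  in the weight given to \<open>k\<close>, because its quadratic term carries the zero diagonal
  entry. An affine function that is bounded below has slope zero.\<close>

lemma psd_on_zero_diagonal:
  assumes psd: "psd_on J P" "finite J" "k \<in> J" "i \<in> J" and 0: "P k k = 0"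
    and herm: "P i k = cnj (P k i)"
  shows "P k i = 0"
proof (cases "i = k")
  case False
  define s where "s = (cmod (P k i))\<^sup>2"
  have s: "P k i * cnj (P k i) = of_real s" by (simp only: complex_norm_square s_def)
  have *: "0 \<le> Re (P i i) - 2 * t * s" for t :: real
  proof -
    \<comment> \<open>The factor \<open>cnj (P k i)\<close> aligns the phases, so that the two cross
      terms add up to \<open>- 2 * t * s\<close>.\<close>
    define c where "c j = (if j = k then - of_real t * cnj (P k i) else 1)" for j
    have "0 \<le> (\<Sum>j\<in>{k, i}. \<Sum>m\<in>{k, i}. c j * cnj (c m) * P j m)"
      using psd_on_subset[OF psd(1,2), of "{k, i}"] psd unfolding psd_on_def by auto
    also have "\<dots> = P i i - 2 * of_real t * (P k i * cnj (P k i))"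
      using False by (simp add: c_def 0 herm algebra_simps)
    also have "\<dots> = P i i - of_real (2 * t * s)" unfolding s by simp
    finally show ?thesis by (simp add: less_eq_complex_def)
  qed
  have "s = 0"
  proof (rule ccontr)
    assume "s \<noteq> 0"
    \<comment> \<open>This \<open>t\<close> makes the right-hand side of \<open>*\<close> equal to
      -1.\<close>
    then show False using *[of "(Re (P i i) + 1) / (2 * s)"] by simp
  qed
  then show ?thesis by (simp add: s_def)
qed (use 0 in simp)

text \<open>The Schur complement of the entry \<open>P k k\<close>, up to diagonal congruence.\<close>

lemma psd_on_insert_iff:
  fixes P P' :: "'i \<Rightarrow> 'i \<Rightarrow> complex" and \<kappa> :: real
  assumes J: "finite J" "k \<notin> J"
    and P: "\<And>i j. i \<in> insert k J \<Longrightarrow> j \<in> insert k J \<Longrightarrow>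
      P i j = of_real \<kappa> * (d i * cnj (d j)) * (1 + m i * cnj (m j) * P' i j)"
    and "\<kappa> > 0" and d: "\<And>i. i \<in> insert k J \<Longrightarrow> d i \<noteq> 0"
    and m: "m k = 0" "\<And>i. i \<in> J \<Longrightarrow> m i \<noteq> 0"
  shows "psd_on (insert k J) P \<longleftrightarrow> psd_on J P'"
proof -
  define Q where "Q c = (\<Sum>i\<in>J. \<Sum>j\<in>J. c i * cnj (c j) * P' i j)" for c
  \<comment> \<open>The form splits into the squared modulus of a linear functional and the form of
    \<open>P'\<close> at rescaled coefficients. Since \<open>m k = 0\<close>, the index
    \<open>k\<close> drops out of the second part.\<close>
  have eq: "(\<Sum>i\<in>insert k J. \<Sum>j\<in>insert k J. c i * cnj (c j) * P i j) =
      of_real \<kappa> * (of_real ((cmod (\<Sum>i\<in>insert k J. c i * d i))\<^sup>2) + Q (\<lambda>i. c i * d i * m i))" for c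
  proof -
    have "(\<Sum>i\<in>insert k J. \<Sum>j\<in>insert k J. c i * cnj (c j) * P i j) =
      (\<Sum>i\<in>insert k J. \<Sum>j\<in>insert k J. of_real \<kappa> * ((c i * d i) * cnj (c j * d j)) +
         of_real \<kappa> * ((c i * d i * m i) * cnj (c j * d j * m j) * P' i j))"
      by (intro sum.cong refl) (simp add: P algebra_simps)
    also have "\<dots> = of_real \<kappa> * ((\<Sum>i\<in>insert k J. c i * d i) * cnj (\<Sum>i\<in>insert k J. c i * d i)) +
        of_real \<kappa> * (\<Sum>i\<in>insert k J. \<Sum>j\<in>insert k J. (c i * d i * m i) * cnj (c j * d j * m j) * P' i j)"
    proof -
      have "(\<Sum>i\<in>insert k J. c i * d i) * cnj (\<Sum>i\<in>insert k J. c i * d i) =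
          (\<Sum>i\<in>insert k J. \<Sum>j\<in>insert k J. (c i * d i) * cnj (c j * d j))"
        by (simp only: cnj_sum sum_product)
      then show ?thesis by (simp only: sum.distrib sum_distrib_left)
    qed
    also have "(\<Sum>i\<in>insert k J. \<Sum>j\<in>insert k J. (c i * d i * m i) * cnj (c j * d j * m j) * P' i j) =
        Q (\<lambda>i. c i * d i * m i)"
      using J m by (simp add: Q_def)
    finally show ?thesis
      by (simp only: complex_norm_square distrib_left)
  qed
  have pos: "0 \<le> of_real \<kappa> * z \<longleftrightarrow> 0 \<le> z" for z :: complex
    using \<open>\<kappa> > 0\<close> by (auto simp: less_eq_complex_def zero_le_mult_iff)
  show ?thesis
  proof
    assume L: "psd_on (insert k J) P"
    show "psd_on J P'"
      unfolding psd_on_def Q_def[symmetric]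
    proof
      fix c
      \<comment> \<open>The coefficient at \<open>k\<close> is chosen to annihilate the linear
        functional, and the others undo the rescaling by \<open>d\<close> and \<open>m\<close>; only
        the form of \<open>P'\<close> at \<open>c\<close> remains.\<close>
      define b where "b i = (if i = k then - (\<Sum>i\<in>J. c i / m i) / d k else c i / (d i * m i))" for i
      have 1: "(\<Sum>i\<in>insert k J. b i * d i) = 0"
      proof -
        have "(\<Sum>i\<in>J. b i * d i) = (\<Sum>i\<in>J. c i / m i)"
          using J d by (intro sum.cong refl) (auto simp: b_def)
        then show ?thesis using J d by (simp add: b_def)
      qed
      have 2: "Q (\<lambda>i. b i * d i * m i) = Q c"
        unfolding Q_def using J d m by (intro sum.cong refl) (auto simp: b_def)
      have "0 \<le> of_real \<kappa> * (of_real ((cmod (\<Sum>i\<in>insert k J. b i * d i))\<^sup>2) + Q (\<lambda>i. b i * d i * m i))"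
        using L unfolding psd_on_def eq by blast
      then show "0 \<le> Q c" unfolding pos 1 2 by simp
    qed
  next
    assume "psd_on J P'"
    then have "0 \<le> Q c" for c unfolding psd_on_def Q_def by blast
    then show "psd_on (insert k J) P"
      unfolding psd_on_def eq pos
      by (intro allI add_nonneg_nonneg) (simp_all add: less_eq_complex_def)
  qed
qed

text \<open>The Pick matrix for the bound 1; other bounds are reduced to it by scaling in
  \<open>H_infinity_Pick\<close>.\<close>

definition pick_kernel :: "('i \<Rightarrow> complex) \<Rightarrow> ('i \<Rightarrow> complex) \<Rightarrow> 'i \<Rightarrow> 'i \<Rightarrow> complex" where
  "pick_kernel l w i j = (1 - w i * cnj (w j)) / (1 - l i * cnj (l j))"

lemma pick_kernel_diagonal_iff:
  assumes "cmod (l i) < 1"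
  shows "0 \<le> pick_kernel l w i i \<longleftrightarrow> cmod (w i) \<le> 1"
proof -
  have "pick_kernel l w i i = of_real ((1 - (cmod (w i))\<^sup>2) / (1 - (cmod (l i))\<^sup>2))"
    by (simp only: pick_kernel_def of_real_divide of_real_diff of_real_1 complex_norm_square)
  moreover have "1 - (cmod (l i))\<^sup>2 > 0" using assms by (simp add: abs_square_less_1)
  ultimately show ?thesis
    using assms by (auto simp: less_eq_complex_def zero_le_divide_iff abs_square_le_1)
qed

text \<open>The kernels \<open>1 - w \<cdot> cnj w'\<close> and \<open>1 - l \<cdot> cnj l'\<close> transform by a diagonal
  congruence under Moebius maps; moving \<open>w k\<close> and \<open>l k\<close> to the origin makes the \<open>k\<close>-th row constant.\<close>

lemma pick_kernel_reduce:
  assumes l: "cmod (l k) < 1" "cmod (l i) < 1" "cmod (l j) < 1"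
    and w: "cmod (w k) < 1" "cmod (w i) \<le> 1" "cmod (w j) \<le> 1"
    and i: "Moebius_function 0 (w k) (w i) = Moebius_function 0 (l k) (l i) * w' i"
    and j: "Moebius_function 0 (w k) (w j) = Moebius_function 0 (l k) (l j) * w' j"
  defines "d \<equiv> (\<lambda>i. (1 - cnj (w k) * w i) / (1 - cnj (l k) * l i))"
  defines "m \<equiv> (\<lambda>i. (l i - l k) / of_real (sqrt (1 - (cmod (l k))\<^sup>2)))"
  shows "pick_kernel l w i j = of_real ((1 - (cmod (l k))\<^sup>2) / (1 - (cmod (w k))\<^sup>2)) *
     (d i * cnj (d j)) * (1 + m i * cnj (m j) * pick_kernel l w' i j)"
proof -
  define A B where "A = 1 - l k * cnj (l k)" and "B = 1 - w k * cnj (w k)"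
  have *: "1 - (cmod (l k))\<^sup>2 > 0" "1 - (cmod (w k))\<^sup>2 > 0"
    using l w by (simp_all add: abs_square_less_1)
  have AB: "A = of_real (1 - (cmod (l k))\<^sup>2)" "B = of_real (1 - (cmod (w k))\<^sup>2)"
    by (simp_all only: A_def B_def of_real_diff of_real_1 complex_norm_square)
  then have "A \<noteq> 0" "B \<noteq> 0" using * by (auto simp del: of_real_diff)
  \<comment> \<open>The square root in \<open>m\<close> shares the factor \<open>1 / A\<close>
    equally between the two indices.\<close>
  have mm: "m i * cnj (m j) = (l i - l k) * cnj (l j - l k) / A"
    using * unfolding m_def AB by (simp flip: of_real_mult)
  define x y a b where xy: "x = 1 - cnj (l k) * l i" "y = 1 - l k * cnj (l j)"
    "a = 1 - cnj (w k) * w i" "b = 1 - w k * cnj (w j)"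
  have nz: "x \<noteq> 0" "y \<noteq> 0" "a \<noteq> 0" "1 - l i * cnj (l j) \<noteq> 0"
    using one_minus_cnj_mult_neq_0[of "l k" "l i"] one_minus_cnj_mult_neq_0[of "l j" "l k"]
      one_minus_cnj_mult_neq_0[of "w k" "w i"] one_minus_cnj_mult_neq_0[of "l j" "l i"] l w
    by (simp_all add: xy mult.commute[of _ "cnj _"])
  have b: "cnj b = 1 - cnj (w k) * w j" and y: "cnj y = 1 - cnj (l k) * l j" by (simp_all add: xy)
  have "cnj b \<noteq> 0" using one_minus_cnj_mult_neq_0[of "w k" "w j"] w by (simp only: b) simp
  then have "b \<noteq> 0" by simp
  have "(w i - w k) / a = ((l i - l k) * w' i) / x"
    using i by (simp add: Moebius_function_simple xy)
  then have wi: "(w i - w k) * x = a * ((l i - l k) * w' i)"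
    using nz by (simp add: frac_eq_eq mult.commute)
  have "(w j - w k) / cnj b = ((l j - l k) * w' j) / cnj y"
    unfolding b y using j by (simp add: Moebius_function_simple)
  then have "(w j - w k) * cnj y = cnj b * ((l j - l k) * w' j)"
    using nz \<open>b \<noteq> 0\<close> by (simp add: frac_eq_eq mult.commute)
  from arg_cong[OF this, of cnj]
  have wj: "cnj (w j - w k) * y = b * cnj ((l j - l k) * w' j)" by simp
  define U V where "U = (l i - l k) * w' i" and "V = cnj ((l j - l k) * w' j)"
  \<comment> \<open>\<open>e1\<close> and \<open>e2\<close> are \<open>Moebius_identity\<close>
    polarised, once for the nodes and once for the values.\<close>
  have e1: "A * (1 - l i * cnj (l j)) = x * y - (l i - l k) * cnj (l j - l k)"
    by (simp add: A_def xy algebra_simps)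
  have e2: "B * (1 - w i * cnj (w j)) = a * b - (w i - w k) * cnj (w j - w k)"
    by (simp add: B_def xy algebra_simps)
  \<comment> \<open>The interpolation equation at \<open>i\<close> times the conjugated one at
    \<open>j\<close>; it trades differences of the values \<open>w\<close> for differences of the
    nodes times the new values \<open>w'\<close>.\<close>
  have e3: "x * y * ((w i - w k) * cnj (w j - w k)) = a * b * (U * V)"
    using arg_cong2[OF wi wj, of "(*)"] by (simp add: U_def V_def mult_ac)
  define L where "L = 1 - l i * cnj (l j)"
  have "1 + m i * cnj (m j) * pick_kernel l w' i j =
      1 + ((l i - l k) * cnj (l j - l k) - U * V) / (A * L)"
    using nz(4) \<open>A \<noteq> 0\<close> unfolding mm pick_kernel_def L_def U_def V_def
    by (simp add: field_simps)
  also have "\<dots> = (x * y - U * V) / (A * L)"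
    using nz(4) \<open>A \<noteq> 0\<close> e1 by (simp add: L_def field_simps)
  finally have 1: "1 + m i * cnj (m j) * pick_kernel l w' i j = (x * y - U * V) / (A * L)" .
  have 2: "d i * cnj (d j) = a * b / (x * y)"
    by (simp add: d_def xy)
  have "x * y * (B * (1 - w i * cnj (w j))) =
      x * y * (a * b) - x * y * ((w i - w k) * cnj (w j - w k))"
    by (subst e2) (rule right_diff_distrib)
  also have "\<dots> = a * b * (x * y - U * V)"
    by (simp only: e3) (simp add: algebra_simps)
  finally have h: "x * y * (B * (1 - w i * cnj (w j))) = a * b * (x * y - U * V)" .
  have "A / B * (a * b / (x * y)) * ((x * y - U * V) / (A * L)) =
      a * b * (x * y - U * V) / (x * y * (B * L))"
    using \<open>A \<noteq> 0\<close> by (simp add: mult_ac)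
  also have "\<dots> = (1 - w i * cnj (w j)) / L"
    unfolding h[symmetric] using nz \<open>B \<noteq> 0\<close> by (simp add: L_def)
  finally have "(1 - w i * cnj (w j)) / L =
      A / B * (a * b / (x * y)) * ((x * y - U * V) / (A * L))" by (rule sym)
  then show ?thesis
    unfolding 1 2 of_real_divide AB[symmetric] by (simp add: pick_kernel_def L_def)
qed

text \<open>The values \<open>w\<close> stay arbitrary in the induction because the Schur step at
  \<open>k\<close> replaces them by new ones. A value of modulus above 1 violates both sides, on the
  matrix side through its diagonal entry. If \<open>w k\<close> is unimodular, both sides say that
  all values agree: the maximum principle gives this for functions, and for the matrix the diagonal
  entry at \<open>k\<close> is zero and annihilates its row.\<close>

theorem Nevanlinna_Pick:
  assumes "finite J" "inj_on l J" "l ` J \<subseteq> disc"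
  shows "(\<exists>f\<in>schur_class. \<forall>i\<in>J. f (l i) = w i) \<longleftrightarrow> psd_on J (pick_kernel l w)"
  using assms
proof (induction J arbitrary: w rule: finite_induct)
  case empty
  have "(\<lambda>_. 0) \<in> schur_class" by (simp add: schur_class_def)
  then show ?case by (auto simp: psd_on_def)
next
  case (insert k J)
  let ?K = "insert k J"
  have l: "cmod (l i) < 1" if "i \<in> ?K" for i using insert.prems that by auto
  have fin: "finite ?K" using insert.hyps by simp
  show ?case
  proof (cases "\<forall>i\<in>?K. cmod (w i) \<le> 1")
    case False
    then obtain i where i: "i \<in> ?K" "\<not> cmod (w i) \<le> 1" by auto
    then have "\<not> psd_on ?K (pick_kernel l w)"
      using psd_on_diagonal[OF _ fin, of "pick_kernel l w" i] pick_kernel_diagonal_iff[of l i w] l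
      by auto
    moreover have "\<not> (\<exists>f\<in>schur_class. \<forall>i\<in>?K. f (l i) = w i)"
      using i l[of i] by (force simp: schur_class_def)
    ultimately show ?thesis by blast
  next
    case True
    then have w: "cmod (w i) \<le> 1" if "i \<in> ?K" for i using that by blast
    show ?thesis
    proof (cases "cmod (w k) = 1")
      case unimodular: True
      then have wk: "w k * cnj (w k) = 1" by (simp add: complex_norm_square[symmetric])
      have "(\<exists>f\<in>schur_class. \<forall>i\<in>?K. f (l i) = w i) \<longleftrightarrow> (\<forall>i\<in>?K. w i = w k)"
      proof
        assume "\<exists>f\<in>schur_class. \<forall>i\<in>?K. f (l i) = w i"
        then obtain f where f: "f \<in> schur_class" "\<forall>i\<in>?K. f (l i) = w i" by blast
        have "w i = w k" if "i \<in> ?K" for i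
          using schur_class_unimodular[OF f(1), of "l k" "l i"] f(2) unimodular l[of k] l[of i] that
          by auto
        then show "\<forall>i\<in>?K. w i = w k" by blast
      next
        assume "\<forall>i\<in>?K. w i = w k"
        then show "\<exists>f\<in>schur_class. \<forall>i\<in>?K. f (l i) = w i"
          using unimodular by (intro bexI[of _ "\<lambda>_. w k"]) (auto simp: schur_class_def)
      qed
      also have "\<dots> \<longleftrightarrow> psd_on ?K (pick_kernel l w)"
      proof
        assume "\<forall>i\<in>?K. w i = w k"
        then have "pick_kernel l w i j = 0" if "i \<in> ?K" "j \<in> ?K" for i j
          using that wk by (metis pick_kernel_def diff_self div_0)
        then show "psd_on ?K (pick_kernel l w)" by (simp add: psd_on_def)
      next
        assume psd: "psd_on ?K (pick_kernel l w)"
        show "\<forall>i\<in>?K. w i = w k"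
        proof
          fix i assume i: "i \<in> ?K"
          have "pick_kernel l w k i = 0"
            by (rule psd_on_zero_diagonal[OF psd fin _ i]) (use wk in \<open>simp_all add: pick_kernel_def mult.commute\<close>)
          moreover have "1 - l k * cnj (l i) \<noteq> 0"
            using one_minus_cnj_mult_neq_0[OF l[OF i] less_imp_le[OF l[of k]]] by (simp add: mult.commute)
          ultimately have "w k * cnj (w i) = 1" by (simp add: pick_kernel_def)
          then have "w k * cnj (w i) = w k * cnj (w k)" using wk by simp
          moreover have "w k \<noteq> 0" using wk by auto
          ultimately show "w i = w k" by (metis complex_cnj_cancel_iff mult_left_cancel)
        qed
      qed
      finally show ?thesis .
    next
      case False
      then have wk: "cmod (w k) < 1" using w[of k] by simp
      have M_nz: "Moebius_function 0 (l k) (l i) \<noteq> 0" if "i \<in> J" for i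
      proof -
        have "l i \<noteq> l k" using insert.prems(1) insert.hyps(2) that by (auto simp: inj_on_def)
        then show ?thesis
          using one_minus_cnj_mult_neq_0[of "l k" "l i"] l[of k] l[of i] that
          by (simp add: Moebius_function_simple)
      qed
      \<comment> \<open>At \<open>i = k\<close> this is 0 / 0 = 0. The product equation that follows
        still holds there, since both of its Moebius factors vanish.\<close>
      define w' where "w' i = Moebius_function 0 (w k) (w i) / Moebius_function 0 (l k) (l i)" for i
      have w': "Moebius_function 0 (w k) (w i) = Moebius_function 0 (l k) (l i) * w' i" if "i \<in> ?K" for i
        using M_nz that by (cases "i = k") (auto simp: w'_def Moebius_function_eq_zero)
      have "(\<exists>f\<in>schur_class. \<forall>i\<in>?K. f (l i) = w i) \<longleftrightarrow> (\<exists>g\<in>schur_class. \<forall>i\<in>J. g (l i) = w' i)"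
      proof
        assume "\<exists>f\<in>schur_class. \<forall>i\<in>?K. f (l i) = w i"
        then obtain f where f: "f \<in> schur_class" "\<forall>i\<in>?K. f (l i) = w i" by blast
        obtain g where g: "g \<in> schur_class"
          "\<And>z. z \<in> disc \<Longrightarrow> Moebius_function 0 (f (l k)) (f z) = Moebius_function 0 (l k) z * g z"
          using schur_reduce[OF f(1), of "l k"] l[of k] wk f(2) by auto
        have "g (l i) = w' i" if "i \<in> J" for i
          using g(2)[of "l i"] f(2) that l[of i] M_nz[OF that] w'[of i] by auto
        with g(1) show "\<exists>g\<in>schur_class. \<forall>i\<in>J. g (l i) = w' i" by blast
      next
        assume "\<exists>g\<in>schur_class. \<forall>i\<in>J. g (l i) = w' i"
        then obtain g where g: "g \<in> schur_class" "\<forall>i\<in>J. g (l i) = w' i" by blast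
        obtain f where f: "f \<in> schur_class" "f (l k) = w k"
          "\<And>z. z \<in> disc \<Longrightarrow> Moebius_function 0 (w k) (f z) = Moebius_function 0 (l k) z * g z"
          using schur_extend[OF g(1), of "l k" "w k"] l[of k] wk by auto
        have "f (l i) = w i" if i: "i \<in> J" for i
        proof -
          have fi: "cmod (f (l i)) \<le> 1" using f(1) l[of i] i by (auto simp: schur_class_def)
          have eq: "Moebius_function 0 (w k) (f (l i)) = Moebius_function 0 (w k) (w i)"
            using f(3)[of "l i"] g(2) w'[of i] i l[of i] by auto
          have "Moebius_function 0 (- w k) (Moebius_function 0 (w k) x) = x" if "cmod x \<le> 1" for x
            using Moebius_function_inverse[of "- w k" x] wk that by simp
          then show ?thesis using eq fi w[of i] i by (metis insertCI)
        qed
        then show "\<exists>f\<in>schur_class. \<forall>i\<in>?K. f (l i) = w i" using f by blast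
      qed
      also have "\<dots> \<longleftrightarrow> psd_on J (pick_kernel l w')"
        using insert.prems by (intro insert.IH) auto
      also have "\<dots> \<longleftrightarrow> psd_on ?K (pick_kernel l w)"
      proof (rule psd_on_insert_iff[symmetric])
        show "pick_kernel l w i j = of_real ((1 - (cmod (l k))\<^sup>2) / (1 - (cmod (w k))\<^sup>2)) *
          ((1 - cnj (w k) * w i) / (1 - cnj (l k) * l i) * cnj ((1 - cnj (w k) * w j) / (1 - cnj (l k) * l j))) *
          (1 + (l i - l k) / of_real (sqrt (1 - (cmod (l k))\<^sup>2)) *
           cnj ((l j - l k) / of_real (sqrt (1 - (cmod (l k))\<^sup>2))) * pick_kernel l w' i j)"
          if "i \<in> ?K" "j \<in> ?K" for i j
          using that by (intro pick_kernel_reduce l w wk w') auto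
        show "0 < (1 - (cmod (l k))\<^sup>2) / (1 - (cmod (w k))\<^sup>2)"
          using wk l[of k] by (simp add: abs_square_less_1)
        show "(1 - cnj (w k) * w i) / (1 - cnj (l k) * l i) \<noteq> 0" if "i \<in> ?K" for i
          using one_minus_cnj_mult_neq_0[OF wk w[OF that]]
            one_minus_cnj_mult_neq_0[OF l[of k], of "l i"] l[OF that] by auto
        show "(l i - l k) / of_real (sqrt (1 - (cmod (l k))\<^sup>2)) \<noteq> 0" if "i \<in> J" for i
        proof -
          have "l i \<noteq> l k" using insert.prems(1) insert.hyps(2) that by (auto simp: inj_on_def)
          moreover have "sqrt (1 - (cmod (l k))\<^sup>2) > 0" using l[of k] by (simp add: abs_square_less_1)
          ultimately show ?thesis by simp
        qed
      qed (use insert.hyps in auto)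
      finally show ?thesis .
    qed
  qed
qed

section \<open>Caratheodory--Schur interpolation\<close>

text \<open>\<open>trunc_bound n C a\<close> bounds multiplication by \<open>a\<close> modulo \<open>X^n\<close> in the \<open>\<ell>\<^sup>2\<close>-norm of the
  coefficients, that is, the operator norm of the \<open>n \<times> n\<close> Toeplitz matrix of \<open>a\<close>.\<close>

definition trunc_norm2 :: "nat \<Rightarrow> complex fps \<Rightarrow> real" where
  "trunc_norm2 n F = (\<Sum>k<n. (cmod (fps_nth F k))\<^sup>2)"

definition trunc_bound :: "nat \<Rightarrow> real \<Rightarrow> complex fps \<Rightarrow> bool" where
  "trunc_bound n C a \<longleftrightarrow> (\<forall>u. trunc_norm2 n (a * u) \<le> C\<^sup>2 * trunc_norm2 n u)"

text \<open>Membership in the ideal generated by \<open>fps_X ^ n\<close>; applied to a difference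
  it is congruence modulo that power.\<close>

definition trunc_zero :: "nat \<Rightarrow> complex fps \<Rightarrow> bool" where
  "trunc_zero n F \<longleftrightarrow> (\<forall>k<n. fps_nth F k = 0)"

lemma trunc_norm2_nonneg: "0 \<le> trunc_norm2 n F"
  by (simp add: trunc_norm2_def sum_nonneg)

lemma trunc_zero_mult: "trunc_zero n F \<Longrightarrow> trunc_zero n (F * G)"
  by (auto simp: trunc_zero_def fps_mult_nth intro!: sum.neutral)

lemma trunc_zero_mult_unit:
  assumes "fps_nth G 0 \<noteq> 0"
  shows "trunc_zero n (F * G) \<longleftrightarrow> trunc_zero n F"
proof
  assume "trunc_zero n (F * G)"
  then have "trunc_zero n (F * G * inverse G)" by (rule trunc_zero_mult)
  also have "F * G * inverse G = F"
    using inverse_mult_eq_1[OF assms] by (simp add: mult.assoc mult.commute[of G])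
  finally show "trunc_zero n F" .
qed (rule trunc_zero_mult)

lemma trunc_zero_Suc_X: "trunc_zero (Suc n) (fps_X * F) \<longleftrightarrow> trunc_zero n F"
  by (auto simp: trunc_zero_def less_Suc_eq_0_disj)

lemma trunc_norm2_Suc_X: "trunc_norm2 (Suc n) (fps_X * F) = trunc_norm2 n F"
  unfolding trunc_norm2_def by (subst sum.lessThan_Suc_shift) simp

lemma trunc_norm2_cong: "trunc_zero n (F - G) \<Longrightarrow> trunc_norm2 n F = trunc_norm2 n G"
  by (simp add: trunc_zero_def trunc_norm2_def)

lemma trunc_bound_cong:
  assumes "trunc_zero n (a - b)"
  shows "trunc_bound n C a \<longleftrightarrow> trunc_bound n C b"
proof -
  have "trunc_norm2 n (a * u) = trunc_norm2 n (b * u)" for u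
    using trunc_zero_mult[OF assms, of u] by (intro trunc_norm2_cong) (simp add: left_diff_distrib)
  then show ?thesis by (simp add: trunc_bound_def)
qed

text \<open>\<open>Moebius_identity\<close> made homogeneous, with a pair of coefficients in place
  of 1 and \<open>z\<close>, and summed. Thus the linear map behind the Moebius transformation
  preserves the indefinite form "norm of \<open>u\<close> minus norm of \<open>y\<close>" up to a
  positive factor; with \<open>y = a * u\<close> the sign of that form expresses
  contractivity.\<close>

lemma trunc_norm2_Moebius:
  "trunc_norm2 n (u - fps_const (cnj c) * y) - trunc_norm2 n (y - fps_const c * u) =
    (1 - (cmod c)\<^sup>2) * (trunc_norm2 n u - trunc_norm2 n y)"
proof -
  have *: "(cmod (p - cnj c * q))\<^sup>2 - (cmod (q - c * p))\<^sup>2 = (1 - (cmod c)\<^sup>2) * ((cmod p)\<^sup>2 - (cmod q)\<^sup>2)"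
    for p q unfolding cmod_power2 by (simp add: algebra_simps power2_eq_square)
  show ?thesis
    by (simp add: trunc_norm2_def sum_subtractf[symmetric] sum_distrib_left * del: sum_subtractf)
qed

text \<open>By \<open>trunc_norm2_Moebius\<close>, \<open>a\<close> acts as a contraction iff \<open>(a - c) / (1 - cnj c * a)\<close> does.\<close>

lemma trunc_bound_Schur_step:
  assumes c: "cmod c < 1" and a0: "fps_nth a 0 = c"
    and ab: "a - fps_const c = (1 - fps_const (cnj c) * a) * (fps_X * b)"
  shows "trunc_bound (Suc n) 1 a \<longleftrightarrow> trunc_bound n 1 b"
proof -
  let ?N = "trunc_norm2 (Suc n)" and ?E = "1 - fps_const (cnj c) * a"
  have pos: "1 - (cmod c)\<^sup>2 > 0" using c by (simp add: abs_square_less_1)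
  have E0: "fps_nth ?E 0 \<noteq> 0" using one_minus_cnj_mult_neq_0[OF c, of c] c a0 by simp
  have iff: "?N (a * u) \<le> ?N u \<longleftrightarrow> trunc_norm2 n (b * (?E * u)) \<le> ?N (?E * u)" for u
  proof -
    have "a * u - fps_const c * u = fps_X * (b * (?E * u))"
    proof -
      have "fps_X * (b * (?E * u)) = (?E * (fps_X * b)) * u" by (simp only: mult_ac)
      also have "\<dots> = a * u - fps_const c * u" unfolding ab[symmetric] by (rule left_diff_distrib)
      finally show ?thesis by (rule sym)
    qed
    moreover have "u - fps_const (cnj c) * (a * u) = ?E * u"
      by (simp add: left_diff_distrib mult.assoc)
    ultimately have "?N (?E * u) - trunc_norm2 n (b * (?E * u)) = (1 - (cmod c)\<^sup>2) * (?N u - ?N (a * u))"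
      using trunc_norm2_Moebius[of "Suc n" u c "a * u"] by (simp only: trunc_norm2_Suc_X)
    then show ?thesis using pos
      by (metis diff_ge_0_iff_ge zero_le_mult_iff not_less_iff_gr_or_eq less_eq_real_def order_less_irrefl)
  qed
  \<comment> \<open>The constant term of \<open>?E\<close> is nonzero, so \<open>?E\<close> is a
    unit and \<open>?E * u\<close> runs through all series as \<open>u\<close> does.\<close>
  have "trunc_bound (Suc n) 1 a \<longleftrightarrow> (\<forall>v. trunc_norm2 n (b * v) \<le> ?N v)"
  proof
    assume L: "trunc_bound (Suc n) 1 a"
    show "\<forall>v. trunc_norm2 n (b * v) \<le> ?N v"
    proof
      fix v
      have "?E * inverse ?E = 1" using inverse_mult_eq_1[OF E0] by (metis mult.commute)
      then have v: "?E * (inverse ?E * v) = v" by (simp only: mult.assoc[symmetric] mult_1_left)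
      show "trunc_norm2 n (b * v) \<le> ?N v"
        using iff[of "inverse ?E * v", unfolded v] L by (simp add: trunc_bound_def)
    qed
  qed (simp add: trunc_bound_def iff)
  \<comment> \<open>The norm of \<open>v\<close> on the left also counts the coefficient at
    \<open>n\<close>, to which the first \<open>n\<close> coefficients of \<open>b * v\<close> are
    blind. Cutting \<open>v\<close> off removes it; this is the disappearance of a row and a
    column.\<close>
  also have "\<dots> \<longleftrightarrow> trunc_bound n 1 b"
  proof
    assume L: "\<forall>v. trunc_norm2 n (b * v) \<le> ?N v"
    show "trunc_bound n 1 b"
      unfolding trunc_bound_def
    proof
      fix v
      have z: "trunc_zero n (v - fps_cutoff n v)" by (simp add: trunc_zero_def)
      have "trunc_norm2 n (b * v) = trunc_norm2 n (b * fps_cutoff n v)"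
        using trunc_zero_mult[OF z, of b] by (intro trunc_norm2_cong) (simp add: right_diff_distrib mult.commute)
      also have "\<dots> \<le> ?N (fps_cutoff n v)" using L by blast
      also have "\<dots> = trunc_norm2 n v" by (simp add: trunc_norm2_def)
      finally show "trunc_norm2 n (b * v) \<le> 1\<^sup>2 * trunc_norm2 n v" by simp
    qed
  next
    assume R: "trunc_bound n 1 b"
    have "trunc_norm2 n (b * v) \<le> ?N v" for v
    proof -
      have "trunc_norm2 n (b * v) \<le> trunc_norm2 n v" using R by (simp add: trunc_bound_def)
      also have "\<dots> \<le> ?N v" by (simp add: trunc_norm2_def)
      finally show ?thesis .
    qed
    then show "\<forall>v. trunc_norm2 n (b * v) \<le> ?N v" ..
  qed
  finally show ?thesis .
qed

text \<open>Subtracting the two step equations and clearing denominators shows that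
  \<open>F - a\<close> and \<open>fps_X * (G - b)\<close> agree up to unit factors; the factor
  \<open>fps_X\<close> accounts for the shift from \<open>n\<close> to \<open>Suc n\<close>.\<close>

lemma trunc_zero_Schur_step:
  assumes c: "cmod c < 1"
    and ab: "a - fps_const c = (1 - fps_const (cnj c) * a) * (fps_X * b)"
    and FG: "F - fps_const c = (1 - fps_const (cnj c) * F) * (fps_X * G)"
  shows "trunc_zero (Suc n) (F - a) \<longleftrightarrow> trunc_zero n (G - b)"
proof -
  define k where "k = fps_const (cnj c)"
  have "fps_nth F 0 = c" using arg_cong[OF FG, of "\<lambda>x. fps_nth x 0"] by simp
  then have E0: "fps_nth (1 - k * F) 0 \<noteq> 0"
    using one_minus_cnj_mult_neq_0[OF c, of c] c by (simp add: k_def)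
  have X0: "fps_nth (1 + k * (fps_X * b)) 0 \<noteq> 0" by (simp add: k_def)
  have "F - a = (1 - k * F) * (fps_X * G) - (1 - k * a) * (fps_X * b)"
  proof -
    have "F - a = (F - fps_const c) - (a - fps_const c)" by simp
    then show ?thesis unfolding FG ab k_def .
  qed
  then have "(F - a) * (1 + k * (fps_X * b)) = (fps_X * (G - b)) * (1 - k * F)"
    by (simp add: algebra_simps)
  then have "trunc_zero (Suc n) (F - a) \<longleftrightarrow> trunc_zero (Suc n) (fps_X * (G - b))"
    using trunc_zero_mult_unit[OF E0] trunc_zero_mult_unit[OF X0] by metis
  then show ?thesis by (simp add: trunc_zero_Suc_X)
qed

section \<open>Taylor coefficients of Schur functions\<close>

lemma has_fps_expansion_taylor_coeff:
  assumes "f holomorphic_on disc"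
  shows "f has_fps_expansion Abs_fps (taylor_coeff f)"
  using has_fps_expansion_fps_expansion[OF open_ball _ assms]
  by (simp add: fps_expansion_def taylor_coeff_def[abs_def])

lemma taylor_coeff_eqI: "f has_fps_expansion F \<Longrightarrow> taylor_coeff f k = fps_nth F k"
  by (simp add: fps_nth_fps_expansion taylor_coeff_def)

text \<open>Carries the Schur step from functions to series. The equation is kept free of
  denominators so that both sides expand by sums and products alone.\<close>

lemma has_fps_expansion_Moebius_eq:
  assumes f: "f has_fps_expansion F" and g: "g has_fps_expansion G"
    and eq: "\<And>z. z \<in> disc \<Longrightarrow> f z - c = (1 - cnj c * f z) * (z * g z)"
  shows "F - fps_const c = (1 - fps_const (cnj c) * F) * (fps_X * G)"
proof (rule fps_expansion_unique_complex)
  show "(\<lambda>z. f z - c) has_fps_expansion F - fps_const c"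
    by (intro fps_expansion_intros f)
  have h: "(\<lambda>z. (1 - cnj c * f z) * (z * g z)) has_fps_expansion
      (1 - fps_const (cnj c) * F) * (fps_X * G)"
    by (intro fps_expansion_intros f g)
  have "eventually (\<lambda>z. z \<in> disc) (nhds (0::complex))"
    by (intro eventually_nhds_in_open) auto
  then have "eventually (\<lambda>z. (1 - cnj c * f z) * (z * g z) = f z - c) (nhds 0)"
    by eventually_elim (simp add: eq)
  from iffD1[OF has_fps_expansion_cong[OF this refl] h]
  show "(\<lambda>z. f z - c) has_fps_expansion (1 - fps_const (cnj c) * F) * (fps_X * G)" .
qed

text \<open>The trichotomy is on the constant coefficient \<open>c\<close>, the prescribed value at
  0. For \<open>cmod c = 1\<close> both sides reduce to \<open>a\<close> being the constant
  \<open>c\<close> modulo the given power: on one side by the maximum principle, on the other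
  because the coefficients have square sum at most 1.\<close>

theorem Caratheodory_Schur:
  "(\<exists>f\<in>schur_class. trunc_zero n (Abs_fps (taylor_coeff f) - a)) \<longleftrightarrow> trunc_bound n 1 a"
proof (induction n arbitrary: a)
  case 0
  have "(\<lambda>_. 0) \<in> schur_class" by (simp add: schur_class_def)
  then show ?case by (auto simp: trunc_zero_def trunc_bound_def trunc_norm2_def)
next
  case (Suc n)
  define c where "c = fps_nth a 0"
  define ex where "ex \<longleftrightarrow> (\<exists>f\<in>schur_class. trunc_zero (Suc n) (Abs_fps (taylor_coeff f) - a))"
  have exE: "\<exists>f\<in>schur_class. f has_fps_expansion Abs_fps (taylor_coeff f) \<and>
     trunc_zero (Suc n) (Abs_fps (taylor_coeff f) - a) \<and> f 0 = c" if e: ex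
  proof -
    obtain f where f: "f \<in> schur_class" "trunc_zero (Suc n) (Abs_fps (taylor_coeff f) - a)"
      using e unfolding ex_def by blast
    have "f has_fps_expansion Abs_fps (taylor_coeff f)"
      using f by (intro has_fps_expansion_taylor_coeff) (simp add: schur_class_def)
    moreover have "f 0 = c" using f(2)[unfolded trunc_zero_def, rule_format, of 0] by (simp add: taylor_coeff_def c_def)
    ultimately show ?thesis using f by blast
  qed
  \<comment> \<open>Testing the bound on the series 1, that is, looking at the first column of the
    Toeplitz matrix.\<close>
  have norm_a: "(\<Sum>k<Suc n. (cmod (fps_nth a k))\<^sup>2) \<le> 1" if "trunc_bound (Suc n) 1 a"
  proof -
    have "trunc_norm2 (Suc n) (1 :: complex fps) = 1"
      unfolding trunc_norm2_def by (subst sum.lessThan_Suc_shift) simp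
    with that[unfolded trunc_bound_def, rule_format, of 1] show ?thesis
      by (simp add: trunc_norm2_def)
  qed
  consider "cmod c > 1" | "cmod c = 1" | "cmod c < 1" by linarith
  then have "ex \<longleftrightarrow> trunc_bound (Suc n) 1 a"
  proof cases
    case 1
    have "\<not> ex"
    proof
      assume ex
      from exE[OF this] obtain f where "f \<in> schur_class" "f 0 = c" by blast
      then show False using 1 by (auto simp: schur_class_def dest: bspec[of _ _ 0])
    qed
    moreover have "\<not> trunc_bound (Suc n) 1 a"
    proof
      assume "trunc_bound (Suc n) 1 a"
      from norm_a[OF this] have "(cmod c)\<^sup>2 + (\<Sum>k<n. (cmod (fps_nth a (Suc k)))\<^sup>2) \<le> 1"
        by (subst (asm) sum.lessThan_Suc_shift) (simp add: c_def)
      moreover have "0 \<le> (\<Sum>k<n. (cmod (fps_nth a (Suc k)))\<^sup>2)" by (simp add: sum_nonneg)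
      moreover have "(cmod c)\<^sup>2 > 1" using 1 by (simp add: one_less_power)
      ultimately show False by linarith
    qed
    ultimately show ?thesis by blast
  next
    case 2
    have const: "(\<lambda>_. c) has_fps_expansion fps_const c" by (rule has_fps_expansion_const)
    have "ex \<longleftrightarrow> trunc_zero (Suc n) (fps_const c - a)"
    proof
      assume ex
      from exE[OF this] obtain f where f: "f \<in> schur_class" "f has_fps_expansion Abs_fps (taylor_coeff f)"
        "trunc_zero (Suc n) (Abs_fps (taylor_coeff f) - a)" "f 0 = c" by blast
      have "f z = c" if "z \<in> disc" for z
        using schur_class_unimodular[OF f(1), of 0 z] that f(4) 2 by simp
      moreover have "eventually (\<lambda>z. z \<in> disc) (nhds (0::complex))"
        by (intro eventually_nhds_in_open) auto
      ultimately have "eventually (\<lambda>z. f z = c) (nhds 0)" by (auto elim: eventually_mono)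
      from iffD1[OF has_fps_expansion_cong[OF this refl] f(2)]
      have "(\<lambda>_. c) has_fps_expansion Abs_fps (taylor_coeff f)" .
      then have "Abs_fps (taylor_coeff f) = fps_const c"
        using fps_expansion_unique_complex const by blast
      with f(3) show "trunc_zero (Suc n) (fps_const c - a)" by simp
    next
      assume "trunc_zero (Suc n) (fps_const c - a)"
      moreover have "Abs_fps (taylor_coeff (\<lambda>_. c)) = fps_const c"
        using taylor_coeff_eqI[OF const] by (simp add: fps_eq_iff)
      moreover have "(\<lambda>_. c) \<in> schur_class" using 2 by (simp add: schur_class_def)
      ultimately show ex unfolding ex_def by metis
    qed
    also have "\<dots> \<longleftrightarrow> trunc_bound (Suc n) 1 a"
    proof
      assume "trunc_zero (Suc n) (fps_const c - a)"
      moreover have "trunc_bound (Suc n) 1 (fps_const c)"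
        using 2 by (simp add: trunc_bound_def trunc_norm2_def norm_mult)
      ultimately show "trunc_bound (Suc n) 1 a" using trunc_bound_cong by blast
    next
      assume "trunc_bound (Suc n) 1 a"
      from norm_a[OF this] have "(\<Sum>k<n. (cmod (fps_nth a (Suc k)))\<^sup>2) \<le> 0"
        using 2 by (subst (asm) sum.lessThan_Suc_shift) (simp add: c_def)
      then have "(\<Sum>k<n. (cmod (fps_nth a (Suc k)))\<^sup>2) = 0"
        by (intro antisym) (simp_all add: sum_nonneg)
      then have "fps_nth a (Suc k) = 0" if "k < n" for k
        using that by (subst (asm) sum_nonneg_eq_0_iff) auto
      then show "trunc_zero (Suc n) (fps_const c - a)"
        by (auto simp: trunc_zero_def less_Suc_eq_0_disj c_def)
    qed
    finally show ?thesis .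
  next
    case 3
    define E where "E = 1 - fps_const (cnj c) * a"
    have E0: "fps_nth E 0 \<noteq> 0"
      using one_minus_cnj_mult_neq_0[OF 3, of c] 3 by (simp add: E_def c_def)
    \<comment> \<open>The quotient \<open>(a - c) / (1 - cnj c * a)\<close> has constant term 0, so
      shifting its coefficients is division by \<open>fps_X\<close>.\<close>
    define b where "b = fps_shift 1 (inverse E * (a - fps_const c))"
    have "fps_X * b = inverse E * (a - fps_const c)"
      by (intro fps_ext) (auto simp: b_def c_def)
    then have "E * (fps_X * b) = a - fps_const c"
      using inverse_mult_eq_1[OF E0] by (simp add: mult.assoc[symmetric] mult.commute[of E])
    then have ab: "a - fps_const c = (1 - fps_const (cnj c) * a) * (fps_X * b)" by (simp add: E_def)
    \<comment> \<open>At \<open>p = 0\<close> the Moebius factor is \<open>z\<close> itself;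
      clearing the denominator gives the form of the step that passes to series.\<close>
    have Moebius_iff: "Moebius_function 0 c x = Moebius_function 0 0 z * y \<longleftrightarrow>
        x - c = (1 - cnj c * x) * (z * y)" if "cmod x \<le> 1" for x y z
      using one_minus_cnj_mult_neq_0[OF 3 that]
      by (simp add: Moebius_function_simple divide_eq_eq mult.commute)
    have "ex \<longleftrightarrow> (\<exists>g\<in>schur_class. trunc_zero n (Abs_fps (taylor_coeff g) - b))"
    proof
      assume ex
      from exE[OF this] obtain f where f: "f \<in> schur_class" "f has_fps_expansion Abs_fps (taylor_coeff f)"
        "trunc_zero (Suc n) (Abs_fps (taylor_coeff f) - a)" "f 0 = c" by blast
      obtain g where g: "g \<in> schur_class"
        "\<And>z. z \<in> disc \<Longrightarrow> Moebius_function 0 c (f z) = Moebius_function 0 0 z * g z"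
        using schur_reduce[OF f(1), of 0] 3 f(4) by auto
      have fg: "f z - c = (1 - cnj c * f z) * (z * g z)" if "z \<in> disc" for z
        using g(2)[OF that] Moebius_iff f(1) that by (simp add: schur_class_def)
      have "g has_fps_expansion Abs_fps (taylor_coeff g)"
        using g(1) by (intro has_fps_expansion_taylor_coeff) (simp add: schur_class_def)
      from has_fps_expansion_Moebius_eq[OF f(2) this fg] f(3)
      have "trunc_zero n (Abs_fps (taylor_coeff g) - b)"
        using trunc_zero_Schur_step[OF 3 ab] by blast
      with g(1) show "\<exists>g\<in>schur_class. trunc_zero n (Abs_fps (taylor_coeff g) - b)" by blast
    next
      assume "\<exists>g\<in>schur_class. trunc_zero n (Abs_fps (taylor_coeff g) - b)"
      then obtain g where g: "g \<in> schur_class" "trunc_zero n (Abs_fps (taylor_coeff g) - b)" by blast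
      obtain f where f: "f \<in> schur_class" "f 0 = c"
        "\<And>z. z \<in> disc \<Longrightarrow> Moebius_function 0 c (f z) = Moebius_function 0 0 z * g z"
        using schur_extend[OF g(1), of 0 c] 3 by auto
      have fg: "f z - c = (1 - cnj c * f z) * (z * g z)" if "z \<in> disc" for z
        using f(3)[OF that] Moebius_iff f(1) that by (simp add: schur_class_def)
      have "g has_fps_expansion Abs_fps (taylor_coeff g)" "f has_fps_expansion Abs_fps (taylor_coeff f)"
        using f(1) g(1) by (auto intro!: has_fps_expansion_taylor_coeff simp: schur_class_def)
      from has_fps_expansion_Moebius_eq[OF this(2,1) fg] g(2)
      have "trunc_zero (Suc n) (Abs_fps (taylor_coeff f) - a)"
        using trunc_zero_Schur_step[OF 3 ab] by blast
      with f(1) show ex unfolding ex_def by blast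
    qed
    also have "\<dots> \<longleftrightarrow> trunc_bound n 1 b" by (rule Suc.IH)
    also have "\<dots> \<longleftrightarrow> trunc_bound (Suc n) 1 a"
      by (rule trunc_bound_Schur_step[OF 3 c_def[symmetric] ab, symmetric])
    finally show ?thesis .
  qed
  then show ?case by (simp add: ex_def)
qed

section \<open>The Banach algebra of bounded analytic functions\<close>

lemma H_infinity_simps [simp]:
  "mult H_infinity f g = (\<lambda>z\<in>disc. f z * g z)"
  "one H_infinity = (\<lambda>z\<in>disc. 1)"
  "zero H_infinity = (\<lambda>z\<in>disc. 0)"
  "add H_infinity f g = (\<lambda>z\<in>disc. f z + g z)"
  "smult H_infinity c f = (\<lambda>z\<in>disc. c * f z)"
  by (simp_all add: H_infinity_def)

lemma H_infinity_carrier_iff: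
  "f \<in> carrier H_infinity \<longleftrightarrow>
    f \<in> extensional disc \<and> f holomorphic_on disc \<and> (\<exists>C. \<forall>z\<in>disc. cmod (f z) \<le> C)"
  by (auto simp: H_infinity_def bounded_iff)

lemma restrict_in_H_infinity:
  assumes "f holomorphic_on disc" "\<And>z. z \<in> disc \<Longrightarrow> cmod (f z) \<le> C"
  shows "(\<lambda>z\<in>disc. f z) \<in> carrier H_infinity"
proof -
  have "(\<lambda>z\<in>disc. f z) holomorphic_on disc"
    using assms(1) by (rule holomorphic_transform) simp
  moreover have "\<forall>z\<in>disc. cmod (restrict f disc z) \<le> C" using assms(2) by simp
  ultimately show ?thesis unfolding H_infinity_carrier_iff by blast
qed

lemma H_infinity_eqI:
  assumes "f \<in> carrier H_infinity" "g \<in> carrier H_infinity" "\<And>z. z \<in> disc \<Longrightarrow> f z = g z"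
  shows "f = g"
  using assms by (intro extensionalityI[of f disc g]) (auto simp: H_infinity_carrier_iff)

lemma H_infinity_restrict_eqI:
  assumes "f \<in> carrier H_infinity" "\<And>z. z \<in> disc \<Longrightarrow> h z = f z"
  shows "(\<lambda>z\<in>disc. h z) = f"
  using assms by (intro extensionalityI[of _ disc f]) (auto simp: H_infinity_carrier_iff)

lemma H_infinity_norm_le_iff:
  assumes "f \<in> carrier H_infinity"
  shows "anorm H_infinity f \<le> C \<longleftrightarrow> (\<forall>z\<in>disc. cmod (f z) \<le> C)"
proof -
  have "bdd_above ((\<lambda>z. cmod (f z)) ` disc)"
    using assms by (auto simp: H_infinity_carrier_iff bdd_above_def)
  then show ?thesis by (auto simp: H_infinity_def cSUP_le_iff)
qed

lemma H_infinity_norm_upper: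
  "f \<in> carrier H_infinity \<Longrightarrow> z \<in> disc \<Longrightarrow> cmod (f z) \<le> anorm H_infinity f"
  using H_infinity_norm_le_iff by blast

lemma H_infinity_norm_nonneg: "f \<in> carrier H_infinity \<Longrightarrow> 0 \<le> anorm H_infinity f"
  by (rule order_trans[OF norm_ge_zero H_infinity_norm_upper[of f 0]]) simp_all

lemma H_infinity_closed:
  assumes f: "f \<in> carrier H_infinity" and g: "g \<in> carrier H_infinity"
  shows "(\<lambda>z\<in>disc. f z + g z) \<in> carrier H_infinity"
    and "(\<lambda>z\<in>disc. f z * g z) \<in> carrier H_infinity"
    and "(\<lambda>z\<in>disc. f z - g z) \<in> carrier H_infinity"
    and "(\<lambda>z\<in>disc. c * f z) \<in> carrier H_infinity"
proof -
  let ?F = "anorm H_infinity f" and ?G = "anorm H_infinity g"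
  have hol: "f holomorphic_on disc" "g holomorphic_on disc"
    using f g by (auto simp: H_infinity_carrier_iff)
  have le: "cmod (f z) \<le> ?F" "cmod (g z) \<le> ?G" if "z \<in> disc" for z
    using H_infinity_norm_upper f g that by auto
  show "(\<lambda>z\<in>disc. f z + g z) \<in> carrier H_infinity"
    by (rule restrict_in_H_infinity[where C = "?F + ?G"])
      (auto intro!: holomorphic_intros hol norm_triangle_le add_mono le)
  show "(\<lambda>z\<in>disc. f z - g z) \<in> carrier H_infinity"
    by (rule restrict_in_H_infinity[where C = "?F + ?G"])
      (auto intro!: holomorphic_intros hol norm_triangle_le_diff add_mono le)
  show "(\<lambda>z\<in>disc. f z * g z) \<in> carrier H_infinity"
    by (rule restrict_in_H_infinity[where C = "?F * ?G"])
      (auto intro!: holomorphic_intros hol mult_mono le H_infinity_norm_nonneg f simp: norm_mult)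
  show "(\<lambda>z\<in>disc. c * f z) \<in> carrier H_infinity"
    by (rule restrict_in_H_infinity[where C = "cmod c * ?F"])
      (auto intro!: holomorphic_intros hol mult_left_mono le simp: norm_mult)
qed

lemma H_infinity_const: "(\<lambda>z\<in>disc. c) \<in> carrier H_infinity"
  by (rule restrict_in_H_infinity[where C = "cmod c"]) auto

lemma restrict_disc_eq_iff: "(\<lambda>z\<in>disc. f z) = (\<lambda>z\<in>disc. g z) \<longleftrightarrow> (\<forall>z\<in>disc. f z = g z)"
  by (metis restrict_apply' restrict_ext)

lemma H_infinity_ring: "ring H_infinity"
proof (rule ringI)
  show "abelian_group H_infinity"
  proof (rule abelian_groupI)
    fix f assume f: "f \<in> carrier H_infinity"
    show "\<exists>g\<in>carrier H_infinity. g \<oplus>\<^bsub>H_infinity\<^esub> f = \<zero>\<^bsub>H_infinity\<^esub>"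
      using H_infinity_closed(4)[OF f f, of "- 1"] by (intro bexI) (auto simp: restrict_disc_eq_iff)
    show "\<zero>\<^bsub>H_infinity\<^esub> \<oplus>\<^bsub>H_infinity\<^esub> f = f"
      unfolding H_infinity_simps by (intro H_infinity_restrict_eqI f) simp
  qed (simp_all add: H_infinity_closed H_infinity_const restrict_disc_eq_iff)
  show "monoid H_infinity"
  proof (rule monoidI)
    fix f assume f: "f \<in> carrier H_infinity"
    show "\<one>\<^bsub>H_infinity\<^esub> \<otimes>\<^bsub>H_infinity\<^esub> f = f" "f \<otimes>\<^bsub>H_infinity\<^esub> \<one>\<^bsub>H_infinity\<^esub> = f"
      unfolding H_infinity_simps by (auto intro!: H_infinity_restrict_eqI f)
  qed (simp_all add: H_infinity_closed H_infinity_const restrict_disc_eq_iff)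
qed (simp_all add: H_infinity_closed restrict_disc_eq_iff algebra_simps)

lemma complex_ring_cring: "cring complex_ring"
proof (rule cringI)
  show "abelian_group complex_ring"
  proof (rule abelian_groupI)
    fix x :: complex
    show "\<exists>y\<in>carrier complex_ring. y \<oplus>\<^bsub>complex_ring\<^esub> x = \<zero>\<^bsub>complex_ring\<^esub>"
      by (auto simp: complex_ring_def intro!: exI[of _ "- x"])
  qed (auto simp: complex_ring_def)
  show "comm_monoid complex_ring"
    by (rule comm_monoidI) (auto simp: complex_ring_def)
qed (auto simp: complex_ring_def algebra_simps)

lemma H_infinity_module: "module complex_ring H_infinity"
proof (rule moduleI)
  interpret ring H_infinity by (rule H_infinity_ring)
  show "abelian_group H_infinity" ..
  show "cring complex_ring" by (rule complex_ring_cring)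
  fix f assume f: "f \<in> carrier H_infinity"
  show "\<one>\<^bsub>complex_ring\<^esub> \<odot>\<^bsub>H_infinity\<^esub> f = f"
    unfolding H_infinity_simps by (intro H_infinity_restrict_eqI f) (simp add: complex_ring_def)
qed (simp_all add: H_infinity_closed restrict_disc_eq_iff complex_ring_def algebra_simps)

lemma H_infinity_minus:
  assumes "f \<in> carrier H_infinity" "g \<in> carrier H_infinity"
  shows "f \<ominus>\<^bsub>H_infinity\<^esub> g = (\<lambda>z\<in>disc. f z - g z)"
proof -
  interpret ring H_infinity by (rule H_infinity_ring)
  have "\<ominus>\<^bsub>H_infinity\<^esub> g = (\<lambda>z\<in>disc. (- 1) * g z)"
    by (intro minus_equality H_infinity_closed(4)[OF assms(2,2)] assms) (simp add: restrict_disc_eq_iff)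
  then show ?thesis by (simp add: a_minus_def restrict_disc_eq_iff)
qed

lemma H_infinity_dist_le_iff:
  assumes "f \<in> carrier H_infinity" "g \<in> carrier H_infinity"
  shows "adist H_infinity f g \<le> C \<longleftrightarrow> (\<forall>z\<in>disc. cmod (f z - g z) \<le> C)"
  using assms by (simp add: adist_def H_infinity_minus H_infinity_norm_le_iff H_infinity_closed)

lemma H_infinity_dist_upper:
  assumes "f \<in> carrier H_infinity" "g \<in> carrier H_infinity" "z \<in> disc"
  shows "cmod (f z - g z) \<le> adist H_infinity f g"
  using H_infinity_dist_le_iff[OF assms(1,2)] assms(3) by blast

lemma H_infinity_Metric_space: "Metric_space (carrier H_infinity) (adist H_infinity)"
proof
  note [simp] = H_infinity_minus H_infinity_closed
  fix f g h
  show "0 \<le> adist H_infinity f g"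
    by (simp add: adist_def H_infinity_norm_nonneg)
  show "adist H_infinity f g = adist H_infinity g f"
  proof (cases "f \<in> carrier H_infinity \<and> g \<in> carrier H_infinity")
    case True
    have "adist H_infinity f g \<le> C \<longleftrightarrow> adist H_infinity g f \<le> C" for C
      using True by (simp add: H_infinity_dist_le_iff norm_minus_commute)
    then show ?thesis by (meson antisym order_refl)
  qed (auto simp: adist_def)
  assume f: "f \<in> carrier H_infinity" and g: "g \<in> carrier H_infinity"
  show "adist H_infinity f g = 0 \<longleftrightarrow> f = g"
  proof
    assume "adist H_infinity f g = 0"
    then have "f z = g z" if "z \<in> disc" for z
      using H_infinity_dist_upper[OF f g that] by simp
    then show "f = g" using f g by (intro H_infinity_eqI)
  next
    assume "f = g"
    then have "adist H_infinity f g \<le> 0" using f by (simp add: H_infinity_dist_le_iff)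
    then show "adist H_infinity f g = 0"
      using f g by (intro antisym) (simp_all add: adist_def H_infinity_norm_nonneg)
  qed
  assume h: "h \<in> carrier H_infinity"
  have "cmod (f z - h z) \<le> adist H_infinity f g + adist H_infinity g h" if "z \<in> disc" for z
    using norm_triangle_ineq[of "f z - g z" "g z - h z"]
      H_infinity_dist_upper[OF f g that] H_infinity_dist_upper[OF g h that] by simp
  then show "adist H_infinity f h \<le> adist H_infinity f g + adist H_infinity g h"
    using f h by (simp add: H_infinity_dist_le_iff)
qed

text \<open>A Cauchy sequence for the sup norm converges uniformly on the whole disc. The
  Weierstrass theorem makes the limit holomorphic, and closeness to a single term makes it
  bounded.\<close>

lemma H_infinity_mcomplete:
  "Metric_space.mcomplete (carrier H_infinity) (adist H_infinity)"
proof -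
  interpret M: Metric_space "carrier H_infinity" "adist H_infinity" by (rule H_infinity_Metric_space)
  show ?thesis
    unfolding M.mcomplete_def
  proof (intro allI impI)
    fix \<sigma> assume C: "M.MCauchy \<sigma>"
    then have \<sigma>: "\<sigma> n \<in> carrier H_infinity" for n by (auto simp: M.MCauchy_def)
    have hol: "\<sigma> n holomorphic_on disc" for n using \<sigma>[of n] by (simp add: H_infinity_carrier_iff)
    have "uniformly_Cauchy_on disc \<sigma>"
      unfolding uniformly_Cauchy_on_def
    proof (intro allI impI)
      fix e :: real assume "e > 0"
      then obtain N where N: "\<And>m n. N \<le> m \<Longrightarrow> N \<le> n \<Longrightarrow> adist H_infinity (\<sigma> m) (\<sigma> n) < e"
        using C unfolding M.MCauchy_def by blast
      have "dist (\<sigma> m z) (\<sigma> n z) < e" if "z \<in> disc" "N \<le> m" "N \<le> n" for z m n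
        using H_infinity_dist_upper[OF \<sigma> \<sigma> that(1), of m n] N[OF that(2,3)]
        by (simp add: dist_norm)
      then show "\<exists>M. \<forall>x\<in>disc. \<forall>m\<ge>M. \<forall>n\<ge>M. dist (\<sigma> m x) (\<sigma> n x) < e" by blast
    qed
    then obtain f where f: "uniform_limit disc \<sigma> f sequentially"
      using uniformly_convergent_eq_Cauchy[of disc \<sigma>] unfolding uniformly_convergent_on_def by blast
    have "f holomorphic_on disc"
    proof (rule holomorphic_uniform_sequence[OF open_ball hol])
      fix z :: complex assume "z \<in> disc"
      then obtain d where "d > 0" "cball z d \<subseteq> disc"
        using open_contains_cball_eq[OF open_ball] by metis
      then show "\<exists>d>0. cball z d \<subseteq> disc \<and> uniform_limit (cball z d) \<sigma> f sequentially"
        using uniform_limit_on_subset[OF f] by blast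
    qed
    moreover obtain N0 where N0: "\<And>z. z \<in> disc \<Longrightarrow> dist (\<sigma> N0 z) (f z) < 1"
      using uniform_limitD[OF f, of 1] unfolding eventually_sequentially by force
    have "cmod (f z) \<le> anorm H_infinity (\<sigma> N0) + 1" if "z \<in> disc" for z
      using N0[OF that] H_infinity_norm_upper[OF \<sigma> that, of N0]
        norm_triangle_ineq2[of "f z" "\<sigma> N0 z"] by (simp add: dist_norm norm_minus_commute)
    ultimately have F: "(\<lambda>z\<in>disc. f z) \<in> carrier H_infinity"
      by (intro restrict_in_H_infinity)
    have "limitin M.mtopology \<sigma> (\<lambda>z\<in>disc. f z) sequentially"
      unfolding M.limitin_metric
    proof (intro conjI F allI impI)
      fix e :: real assume "e > 0"
      \<comment> \<open>Half of \<open>e\<close>, because a strict pointwise bound leaves only a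
        non-strict one for the supremum.\<close>
      then have "eventually (\<lambda>n. \<forall>z\<in>disc. dist (\<sigma> n z) (f z) < e / 2) sequentially"
        using uniform_limitD[OF f, of "e / 2"] by simp
      then show "eventually (\<lambda>n. \<sigma> n \<in> carrier H_infinity \<and>
          adist H_infinity (\<sigma> n) (\<lambda>z\<in>disc. f z) < e) sequentially"
      proof eventually_elim
        case (elim n)
        then have "adist H_infinity (\<sigma> n) (\<lambda>z\<in>disc. f z) \<le> e / 2"
          using F \<sigma> by (subst H_infinity_dist_le_iff) (auto simp: dist_norm intro: less_imp_le)
        with \<sigma> \<open>e > 0\<close> show ?case by simp
      qed
    qed
    then show "\<exists>x. limitin M.mtopology \<sigma> x sequentially" by blast
  qed
qed

lemma H_infinity_banach: "unital_banach_algebra H_infinity"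
proof -
  interpret ring H_infinity by (rule H_infinity_ring)
  interpret module complex_ring H_infinity by (rule H_infinity_module)
  note [simp] = H_infinity_closed H_infinity_const
  show ?thesis
  proof
    fix f assume f: "f \<in> carrier H_infinity"
    show "0 \<le> anorm H_infinity f" by (rule H_infinity_norm_nonneg[OF f])
    show "anorm H_infinity f = 0 \<longleftrightarrow> f = \<zero>\<^bsub>H_infinity\<^esub>"
    proof
      assume "anorm H_infinity f = 0"
      then have "f z = 0" if "z \<in> disc" for z using H_infinity_norm_upper[OF f that] by simp
      then show "f = \<zero>\<^bsub>H_infinity\<^esub>" using f by (intro H_infinity_eqI) auto
    next
      assume "f = \<zero>\<^bsub>H_infinity\<^esub>"
      then have "anorm H_infinity f \<le> 0" using f by (subst H_infinity_norm_le_iff) auto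
      then show "anorm H_infinity f = 0" using H_infinity_norm_nonneg[OF f] by simp
    qed
    show "anorm H_infinity (c \<odot>\<^bsub>H_infinity\<^esub> f) = cmod c * anorm H_infinity f" for c
    proof -
      \<comment> \<open>Used for \<open>c\<close> and again for \<open>inverse c\<close>, this one
        inequality gives equality.\<close>
      have le: "anorm H_infinity (\<lambda>z\<in>disc. a * g z) \<le> cmod a * anorm H_infinity g"
        if "g \<in> carrier H_infinity" for a g
        using that by (subst H_infinity_norm_le_iff)
          (auto simp: norm_mult intro!: mult_left_mono H_infinity_norm_upper)
      show ?thesis
      proof (cases "c = 0")
        case True
        then show ?thesis using le[OF f, of c] H_infinity_norm_nonneg[of "\<lambda>z\<in>disc. c * f z"] f
          by (intro antisym) auto
      next
        case False
        have "(\<lambda>z\<in>disc. inverse c * (\<lambda>z\<in>disc. c * f z) z) = f"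
          using False by (intro H_infinity_restrict_eqI f) simp
        then have "anorm H_infinity f \<le> cmod (inverse c) * anorm H_infinity (\<lambda>z\<in>disc. c * f z)"
          using le[of "\<lambda>z\<in>disc. c * f z" "inverse c"] f by (simp only: H_infinity_closed)
        then have "cmod c * anorm H_infinity f \<le> anorm H_infinity (\<lambda>z\<in>disc. c * f z)"
          using False by (simp add: norm_inverse norm_divide field_simps)
        then show ?thesis using le[OF f, of c] by simp
      qed
    qed
    fix g assume g: "g \<in> carrier H_infinity"
    show "anorm H_infinity (f \<oplus>\<^bsub>H_infinity\<^esub> g) \<le> anorm H_infinity f + anorm H_infinity g"
      using f g by (simp add: H_infinity_norm_le_iff)
        (auto intro!: norm_triangle_le add_mono H_infinity_norm_upper)
    show "anorm H_infinity (f \<otimes>\<^bsub>H_infinity\<^esub> g) \<le> anorm H_infinity f * anorm H_infinity g"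
      using f g by (simp add: H_infinity_norm_le_iff)
        (auto simp: norm_mult intro!: mult_mono H_infinity_norm_upper H_infinity_norm_nonneg)
    show "(c \<odot>\<^bsub>H_infinity\<^esub> f) \<otimes>\<^bsub>H_infinity\<^esub> g = c \<odot>\<^bsub>H_infinity\<^esub> (f \<otimes>\<^bsub>H_infinity\<^esub> g)" for c
      by (simp add: restrict_disc_eq_iff)
    show "f \<otimes>\<^bsub>H_infinity\<^esub> (c \<odot>\<^bsub>H_infinity\<^esub> g) = c \<odot>\<^bsub>H_infinity\<^esub> (f \<otimes>\<^bsub>H_infinity\<^esub> g)" for c
      by (simp add: restrict_disc_eq_iff)
  next
    show "anorm H_infinity \<one>\<^bsub>H_infinity\<^esub> = 1"
      using H_infinity_norm_upper[OF H_infinity_const[of 1], of 0]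
      by (intro antisym) (simp_all add: H_infinity_norm_le_iff)
  qed (rule H_infinity_mcomplete)
qed

section \<open>Quotients and inverse limits\<close>

text \<open>The first isomorphism theorem with norms. By \<open>norm_le\<close> together with
  surjectivity, \<open>\<Psi>\<close> maps each closed ball of \<open>A\<close> onto the closed ball
  of \<open>B\<close> with the same radius, which is the place where an interpolation theorem
  enters. The cosets are the fibers of \<open>\<Psi>\<close>, so the image of a coset is a singleton
  and \<open>the_elem\<close> extracts its member.\<close>

lemma quotient_algebra_isometric_iso:
  fixes A :: "('a, 'b) normed_algebra_scheme" and B :: "('c, 'd) normed_algebra_scheme"
  assumes "ring A" "ideal I A"
    and smult_closed: "\<And>c x. x \<in> carrier A \<Longrightarrow> c \<odot>\<^bsub>A\<^esub> x \<in> carrier A"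
    and norm_nonneg: "\<And>x. x \<in> carrier A \<Longrightarrow> 0 \<le> anorm A x"
    and hom: "\<Psi> \<in> Ring.ring_hom A B" "\<Psi> ` carrier A = carrier B"
    and hom_smult: "\<And>c x. x \<in> carrier A \<Longrightarrow> \<Psi> (c \<odot>\<^bsub>A\<^esub> x) = c \<odot>\<^bsub>B\<^esub> \<Psi> x"
    and ker: "\<And>x y. x \<in> carrier A \<Longrightarrow> y \<in> carrier A \<Longrightarrow> \<Psi> x = \<Psi> y \<longleftrightarrow> x \<ominus>\<^bsub>A\<^esub> y \<in> I"
    and norm_Psi_nonneg: "\<And>x. x \<in> carrier A \<Longrightarrow> 0 \<le> anorm B (\<Psi> x)"
    and norm_le: "\<And>x C. x \<in> carrier A \<Longrightarrow> 0 \<le> C \<Longrightarrow>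
      anorm B (\<Psi> x) \<le> C \<longleftrightarrow> (\<exists>y\<in>carrier A. anorm A y \<le> C \<and> \<Psi> y = \<Psi> x)"
  shows "(\<lambda>X. the_elem (\<Psi> ` X)) \<in> isometric_iso (quotient_algebra A I) B"
    and "\<And>x. x \<in> carrier A \<Longrightarrow> the_elem (\<Psi> ` (I +>\<^bsub>A\<^esub> x)) = \<Psi> x"
proof -
  interpret ring A by fact
  interpret I: ideal I A by fact
  let ?\<Phi> = "\<lambda>X. the_elem (\<Psi> ` X)"
  have fiber: "I +>\<^bsub>A\<^esub> x = {y \<in> carrier A. \<Psi> y = \<Psi> x}" if x: "x \<in> carrier A" for x
  proof (intro equalityI subsetI)
    fix y assume "y \<in> I +>\<^bsub>A\<^esub> x"
    then obtain h where h: "h \<in> I" "y = h \<oplus>\<^bsub>A\<^esub> x" by (auto simp: a_r_coset_def')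
    moreover have hc: "h \<in> carrier A" using h I.a_subset by blast
    ultimately have "y \<ominus>\<^bsub>A\<^esub> x = h" using x by (simp add: a_minus_def a_assoc r_neg)
    then show "y \<in> {y \<in> carrier A. \<Psi> y = \<Psi> x}" using ker[of y x] h hc x by simp
  next
    fix y assume "y \<in> {y \<in> carrier A. \<Psi> y = \<Psi> x}"
    then have y: "y \<in> carrier A" "y \<ominus>\<^bsub>A\<^esub> x \<in> I" using ker x by auto
    have "y = (y \<ominus>\<^bsub>A\<^esub> x) \<oplus>\<^bsub>A\<^esub> x" using x y(1) by (simp add: a_minus_def a_assoc l_neg)
    then show "y \<in> I +>\<^bsub>A\<^esub> x" using y by (auto simp: a_r_coset_def')
  qed
  show coset: "?\<Phi> (I +>\<^bsub>A\<^esub> x) = \<Psi> x" if "x \<in> carrier A" for x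
  proof -
    have "\<Psi> ` (I +>\<^bsub>A\<^esub> x) = {\<Psi> x}" using that by (auto simp: fiber)
    then show ?thesis by simp
  qed
  have car: "carrier (quotient_algebra A I) = (\<lambda>x. I +>\<^bsub>A\<^esub> x) ` carrier A"
    by (auto simp: quotient_algebra_def FactRing_def A_RCOSETS_def')
  have one: "one (quotient_algebra A I) = I +>\<^bsub>A\<^esub> \<one>\<^bsub>A\<^esub>"
    by (simp add: quotient_algebra_def FactRing_def)
  have mult: "(I +>\<^bsub>A\<^esub> x) \<otimes>\<^bsub>quotient_algebra A I\<^esub> (I +>\<^bsub>A\<^esub> y) = I +>\<^bsub>A\<^esub> (x \<otimes>\<^bsub>A\<^esub> y)"
    and add: "(I +>\<^bsub>A\<^esub> x) \<oplus>\<^bsub>quotient_algebra A I\<^esub> (I +>\<^bsub>A\<^esub> y) = I +>\<^bsub>A\<^esub> (x \<oplus>\<^bsub>A\<^esub> y)"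
    if "x \<in> carrier A" "y \<in> carrier A" for x y
    using that by (simp_all add: quotient_algebra_def FactRing_def I.rcoset_mult_add I.a_rcos_sum)
  have smult: "c \<odot>\<^bsub>quotient_algebra A I\<^esub> (I +>\<^bsub>A\<^esub> x) = I +>\<^bsub>A\<^esub> (c \<odot>\<^bsub>A\<^esub> x)"
    if x: "x \<in> carrier A" for c x
  proof -
    have eq: "I +>\<^bsub>A\<^esub> (c \<odot>\<^bsub>A\<^esub> y) = I +>\<^bsub>A\<^esub> (c \<odot>\<^bsub>A\<^esub> x)" if "y \<in> I +>\<^bsub>A\<^esub> x" for y
      using that x by (simp add: fiber smult_closed hom_smult)
    have "x \<in> I +>\<^bsub>A\<^esub> x" using x by (simp add: fiber)
    then have "(\<Union>y\<in>I +>\<^bsub>A\<^esub> x. I +>\<^bsub>A\<^esub> (c \<odot>\<^bsub>A\<^esub> y)) = I +>\<^bsub>A\<^esub> (c \<odot>\<^bsub>A\<^esub> x)"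
      using eq by blast
    then show ?thesis by (simp add: quotient_algebra_def)
  qed
  have norm: "anorm (quotient_algebra A I) (I +>\<^bsub>A\<^esub> x) = anorm B (\<Psi> x)"
    if x: "x \<in> carrier A" for x
  proof -
    have "anorm (quotient_algebra A I) (I +>\<^bsub>A\<^esub> x) = (INF y\<in>I +>\<^bsub>A\<^esub> x. anorm A y)"
      by (simp add: quotient_algebra_def)
    also have "\<dots> = anorm B (\<Psi> x)"
    proof (rule antisym)
      \<comment> \<open>With the norm of \<open>\<Psi> x\<close> itself as the bound,
        \<open>norm_le\<close> yields a representative that attains the infimum.\<close>
      obtain y where y: "y \<in> carrier A" "anorm A y \<le> anorm B (\<Psi> x)" "\<Psi> y = \<Psi> x"
        using norm_le[OF x norm_Psi_nonneg[OF x]] by auto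
      have "bdd_below (anorm A ` (I +>\<^bsub>A\<^esub> x))"
        using x norm_nonneg by (intro bdd_belowI2[of _ 0]) (simp add: fiber)
      then have "(INF y\<in>I +>\<^bsub>A\<^esub> x. anorm A y) \<le> anorm A y"
        using x y by (intro cINF_lower) (simp_all add: fiber)
      then show "(INF y\<in>I +>\<^bsub>A\<^esub> x. anorm A y) \<le> anorm B (\<Psi> x)" using y by simp
    next
      show "anorm B (\<Psi> x) \<le> (INF y\<in>I +>\<^bsub>A\<^esub> x. anorm A y)"
      proof (rule cINF_greatest)
        show "I +>\<^bsub>A\<^esub> x \<noteq> {}" using x by (auto simp: fiber)
        fix y assume "y \<in> I +>\<^bsub>A\<^esub> x"
        then have y: "y \<in> carrier A" "\<Psi> y = \<Psi> x" using x by (auto simp: fiber)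
        then show "anorm B (\<Psi> x) \<le> anorm A y" using norm_le[OF x norm_nonneg[OF y(1)]] by auto
      qed
    qed
    finally show ?thesis .
  qed
  show "?\<Phi> \<in> isometric_iso (quotient_algebra A I) B"
    unfolding isometric_iso_def ring_iso_def
  proof (intro CollectI conjI ring_hom_memI allI ballI)
    show "?\<Phi> X \<in> carrier B" if "X \<in> carrier (quotient_algebra A I)" for X
      using that hom(2) coset unfolding car by force
    show "?\<Phi> (X \<otimes>\<^bsub>quotient_algebra A I\<^esub> Y) = ?\<Phi> X \<otimes>\<^bsub>B\<^esub> ?\<Phi> Y"
      "?\<Phi> (X \<oplus>\<^bsub>quotient_algebra A I\<^esub> Y) = ?\<Phi> X \<oplus>\<^bsub>B\<^esub> ?\<Phi> Y"
      if XY: "X \<in> carrier (quotient_algebra A I)" "Y \<in> carrier (quotient_algebra A I)" for X Y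
    proof -
      obtain x y where "X = I +>\<^bsub>A\<^esub> x" "Y = I +>\<^bsub>A\<^esub> y" "x \<in> carrier A" "y \<in> carrier A"
        using XY unfolding car by blast
      then show "?\<Phi> (X \<otimes>\<^bsub>quotient_algebra A I\<^esub> Y) = ?\<Phi> X \<otimes>\<^bsub>B\<^esub> ?\<Phi> Y"
        "?\<Phi> (X \<oplus>\<^bsub>quotient_algebra A I\<^esub> Y) = ?\<Phi> X \<oplus>\<^bsub>B\<^esub> ?\<Phi> Y"
        by (simp_all only: mult add coset m_closed a_closed ring_hom_mult[OF hom(1)] ring_hom_add[OF hom(1)])
    qed
    show "?\<Phi> \<one>\<^bsub>quotient_algebra A I\<^esub> = \<one>\<^bsub>B\<^esub>"
      using ring_hom_one[OF hom(1)] by (simp add: one coset)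
    show "bij_betw ?\<Phi> (carrier (quotient_algebra A I)) (carrier B)"
      unfolding bij_betw_def
    proof
      show "inj_on ?\<Phi> (carrier (quotient_algebra A I))"
      proof (rule inj_onI)
        fix X Y
        assume XY: "X \<in> carrier (quotient_algebra A I)" "Y \<in> carrier (quotient_algebra A I)"
          and eq: "?\<Phi> X = ?\<Phi> Y"
        obtain x y where xy: "X = I +>\<^bsub>A\<^esub> x" "Y = I +>\<^bsub>A\<^esub> y" "x \<in> carrier A" "y \<in> carrier A"
          using XY unfolding car by blast
        then have "\<Psi> x = \<Psi> y" using eq coset by simp
        with xy show "X = Y" by (simp only: fiber)
      qed
      show "?\<Phi> ` carrier (quotient_algebra A I) = carrier B"
        unfolding car image_image hom(2)[symmetric] by (intro image_cong refl coset)
    qed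
    show "?\<Phi> (c \<odot>\<^bsub>quotient_algebra A I\<^esub> X) = c \<odot>\<^bsub>B\<^esub> ?\<Phi> X"
      "anorm B (?\<Phi> X) = anorm (quotient_algebra A I) X"
      if X: "X \<in> carrier (quotient_algebra A I)" for c X
    proof -
      obtain x where "X = I +>\<^bsub>A\<^esub> x" "x \<in> carrier A"
        using X unfolding car by blast
      then show "?\<Phi> (c \<odot>\<^bsub>quotient_algebra A I\<^esub> X) = c \<odot>\<^bsub>B\<^esub> ?\<Phi> X"
        "anorm B (?\<Phi> X) = anorm (quotient_algebra A I) X"
        by (simp_all only: smult norm coset smult_closed hom_smult)
    qed
  qed
qed

lemma bounded_limit_isometric_iso:
  fixes Q :: "nat \<Rightarrow> ('a, 'b) normed_algebra_scheme" and B :: "nat \<Rightarrow> ('c, 'd) normed_algebra_scheme"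
  assumes iso: "\<And>r. \<Phi> r \<in> isometric_iso (Q r) (B r)"
    and closed: "\<And>r s x. r \<le> s \<Longrightarrow> x \<in> carrier (Q s) \<Longrightarrow> p r x \<in> carrier (Q r)"
    and compat: "\<And>r s x. r \<le> s \<Longrightarrow> x \<in> carrier (Q s) \<Longrightarrow> q r (\<Phi> s x) = \<Phi> r (p r x)"
  shows "(\<lambda>a r. \<Phi> r (a r)) \<in> isometric_iso (bounded_limit Q p) (bounded_limit B q)"
proof -
  have hom: "\<Phi> r \<in> Ring.ring_hom (Q r) (B r)" and bij: "bij_betw (\<Phi> r) (carrier (Q r)) (carrier (B r))"
    and smult: "x \<in> carrier (Q r) \<Longrightarrow> \<Phi> r (c \<odot>\<^bsub>Q r\<^esub> x) = c \<odot>\<^bsub>B r\<^esub> \<Phi> r x"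
    and norm: "x \<in> carrier (Q r) \<Longrightarrow> anorm (B r) (\<Phi> r x) = anorm (Q r) x" for r c x
    using iso[of r] by (auto simp: isometric_iso_def ring_iso_def)
  have inj: "inj_on (\<Phi> r) (carrier (Q r))" for r using bij[of r] by (simp add: bij_betw_def)
  have car_eq: "\<Phi> r x \<in> carrier (B r)" if "x \<in> carrier (Q r)" for r x
    using bij[of r] that by (auto simp: bij_betw_def)
  let ?F = "\<lambda>a r. \<Phi> r (a r)"
  \<comment> \<open>An equivalence, since surjectivity has to pull compatible sequences back;
    injectivity of each \<open>\<Phi> r\<close> reflects compatibility, and the isometries preserve
    boundedness.\<close>
  have mem: "?F a \<in> carrier (bounded_limit B q) \<longleftrightarrow> a \<in> carrier (bounded_limit Q p)"
    if a: "\<And>r. a r \<in> carrier (Q r)" for a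
  proof -
    have "q r (\<Phi> s (a s)) = \<Phi> r (a r) \<longleftrightarrow> p r (a s) = a r" if "r \<le> s" for r s
      using compat[OF that a] inj_on_eq_iff[OF inj closed[OF that a] a] by simp
    then show ?thesis using a by (simp add: bounded_limit_def norm car_eq)
  qed
  have car: "a r \<in> carrier (Q r)" if "a \<in> carrier (bounded_limit Q p)" for a r
    using that by (simp add: bounded_limit_def)
  show ?thesis
    unfolding isometric_iso_def ring_iso_def
  proof (intro CollectI conjI ring_hom_memI allI ballI)
    show "?F a \<in> carrier (bounded_limit B q)" if "a \<in> carrier (bounded_limit Q p)" for a
      using mem[of a] car that by blast
    show "?F (a \<otimes>\<^bsub>bounded_limit Q p\<^esub> b) = ?F a \<otimes>\<^bsub>bounded_limit B q\<^esub> ?F b"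
      "?F (a \<oplus>\<^bsub>bounded_limit Q p\<^esub> b) = ?F a \<oplus>\<^bsub>bounded_limit B q\<^esub> ?F b"
      if "a \<in> carrier (bounded_limit Q p)" "b \<in> carrier (bounded_limit Q p)" for a b
      using car[OF that(1)] car[OF that(2)] ring_hom_mult[OF hom] ring_hom_add[OF hom]
      by (auto simp: bounded_limit_def)
    show "?F \<one>\<^bsub>bounded_limit Q p\<^esub> = \<one>\<^bsub>bounded_limit B q\<^esub>"
      using ring_hom_one[OF hom] by (auto simp: bounded_limit_def)
    show "bij_betw ?F (carrier (bounded_limit Q p)) (carrier (bounded_limit B q))"
      unfolding bij_betw_def
    proof
      show "inj_on ?F (carrier (bounded_limit Q p))"
      proof (rule inj_onI, rule ext)
        fix a b r assume ab: "a \<in> carrier (bounded_limit Q p)" "b \<in> carrier (bounded_limit Q p)" "?F a = ?F b"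
        then show "a r = b r" using inj_onD[OF inj _ car[OF ab(1)] car[OF ab(2)]] by meson
      qed
      show "?F ` carrier (bounded_limit Q p) = carrier (bounded_limit B q)"
      proof (intro equalityI subsetI)
        fix b assume "b \<in> ?F ` carrier (bounded_limit Q p)"
        then show "b \<in> carrier (bounded_limit B q)" using mem car by blast
      next
        fix b assume b: "b \<in> carrier (bounded_limit B q)"
        define a where "a r = inv_into (carrier (Q r)) (\<Phi> r) (b r)" for r
        have im: "b r \<in> \<Phi> r ` carrier (Q r)" for r
          using b bij[of r] by (simp add: bounded_limit_def bij_betw_def)
        have "a r \<in> carrier (Q r)" "\<Phi> r (a r) = b r" for r
          unfolding a_def by (rule inv_into_into[OF im], rule f_inv_into_f[OF im])
        then have "a \<in> carrier (bounded_limit Q p)" "?F a = b"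
          using mem[of a] b by simp_all
        then show "b \<in> ?F ` carrier (bounded_limit Q p)" by blast
      qed
    qed
    show "?F (c \<odot>\<^bsub>bounded_limit Q p\<^esub> a) = c \<odot>\<^bsub>bounded_limit B q\<^esub> ?F a"
      "anorm (bounded_limit B q) (?F a) = anorm (bounded_limit Q p) a"
      if "a \<in> carrier (bounded_limit Q p)" for c a
      using car[OF that] by (simp_all add: bounded_limit_def smult norm)
  qed
qed

text \<open>Every element of a quotient is a coset of some \<open>x\<close> in \<open>A\<close>, so
  the connecting maps need comparing only on the images \<open>\<Psi> r x\<close> of one and the
  same \<open>x\<close>.\<close>

lemma detection_envelope_isometric_iso:
  fixes A :: "('a, 'b) normed_algebra_scheme" and B :: "nat \<Rightarrow> ('c, 'd) normed_algebra_scheme"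
  assumes filtration: "detection_filtration A I"
    and iso: "\<And>r. \<Phi> r \<in> isometric_iso (quotient_algebra A (I r)) (B r)"
    and coset: "\<And>r x. x \<in> carrier A \<Longrightarrow> \<Phi> r (I r +>\<^bsub>A\<^esub> x) = \<Psi> r x"
    and compat: "\<And>r s x. r \<le> s \<Longrightarrow> x \<in> carrier A \<Longrightarrow> q r (\<Psi> s x) = \<Psi> r x"
  shows "(\<lambda>a r. \<Phi> r (a r)) \<in> isometric_iso (detection_envelope A I) (bounded_limit B q)"
proof -
  interpret detection_filtration A I by (rule filtration)
  have car: "carrier (quotient_algebra A (I r)) = (\<lambda>x. I r +>\<^bsub>A\<^esub> x) ` carrier A" for r
    by (auto simp: quotient_algebra_def FactRing_def A_RCOSETS_def')
  have proj: "quotient_proj A (I r) (I s +>\<^bsub>A\<^esub> x) = I r +>\<^bsub>A\<^esub> x" if "r \<le> s" "x \<in> carrier A" for r s x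
    using quotient_proj_coset[OF two_sided_ideal two_sided_ideal decreasing[OF that(1)] that(2)] .
  show ?thesis
    unfolding detection_envelope_def
    by (rule bounded_limit_isometric_iso[OF iso]) (auto simp: car proj coset compat)
qed

text \<open>The common frame of both filtrations. Each ideal is a joint kernel of functionals:
  contractivity makes it closed, and the dual family \<open>e\<close> makes it proper and spans a
  complement.\<close>

lemma H_infinity_filtration:
  fixes \<phi> :: "nat \<Rightarrow> (complex \<Rightarrow> complex) \<Rightarrow> complex"
  assumes I: "\<And>r. I r = {f \<in> carrier H_infinity. \<forall>i\<le>r. \<phi> i f = 0}"
    and add: "\<And>i f g. f \<in> carrier H_infinity \<Longrightarrow> g \<in> carrier H_infinity \<Longrightarrow>
      \<phi> i (\<lambda>z\<in>disc. f z + g z) = \<phi> i f + \<phi> i g"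
    and smult: "\<And>i f c. f \<in> carrier H_infinity \<Longrightarrow> \<phi> i (\<lambda>z\<in>disc. c * f z) = c * \<phi> i f"
    and bound: "\<And>i f. f \<in> carrier H_infinity \<Longrightarrow> cmod (\<phi> i f) \<le> anorm H_infinity f"
    and mult: "\<And>r f g. f \<in> I r \<Longrightarrow> g \<in> carrier H_infinity \<Longrightarrow> (\<lambda>z\<in>disc. f z * g z) \<in> I r"
    and dual: "\<And>r j. j \<le> r \<Longrightarrow> e r j \<in> carrier H_infinity"
      "\<And>r i j. i \<le> r \<Longrightarrow> j \<le> r \<Longrightarrow> \<phi> i (e r j) = (if i = j then 1 else 0)"
  shows "detection_filtration H_infinity I"
proof -
  interpret ring H_infinity by (rule H_infinity_ring)
  interpret M: Metric_space "carrier H_infinity" "adist H_infinity" by (rule H_infinity_Metric_space)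
  have zero: "\<phi> i (\<lambda>z\<in>disc. 0) = 0" for i
    using smult[of "\<lambda>z\<in>disc. 0" i 0] H_infinity_const by simp
  have minus: "\<phi> i (\<lambda>z\<in>disc. f z - g z) = \<phi> i f - \<phi> i g"
    if "f \<in> carrier H_infinity" "g \<in> carrier H_infinity" for i f g
  proof -
    have "(\<lambda>z\<in>disc. f z - g z) = (\<lambda>z\<in>disc. f z + (\<lambda>z\<in>disc. (- 1) * g z) z)"
      by (simp add: restrict_disc_eq_iff)
    then show ?thesis
      using add[OF that(1) H_infinity_closed(4)[OF that(2,2), of "- 1"], of i] smult[OF that(2), of i "- 1"]
      by simp
  qed
  show ?thesis
  proof (intro detection_filtration.intro detection_filtration_axioms.intro H_infinity_banach)
    fix r
    have sub: "I r \<subseteq> carrier H_infinity" by (auto simp: I)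
    have minus_closed: "f \<ominus>\<^bsub>H_infinity\<^esub> g \<in> I r" if "f \<in> I r" "g \<in> I r" for f g
      using that by (simp add: I H_infinity_minus H_infinity_closed minus)
    show "ideal (I r) H_infinity"
    proof (rule idealI)
      show "ring H_infinity" by (rule H_infinity_ring)
      have 0: "\<zero>\<^bsub>H_infinity\<^esub> \<in> I r" by (simp only: I H_infinity_simps) (simp add: H_infinity_const zero)
      show "subgroup (I r) (add_monoid H_infinity)"
      proof (rule add.subgroupI)
        fix f g assume f: "f \<in> I r" and g: "g \<in> I r"
        show "\<ominus>\<^bsub>H_infinity\<^esub> f \<in> I r"
          using minus_closed[OF 0 f] f sub by (simp add: a_minus_def subset_iff del: H_infinity_simps)
        show "f \<oplus>\<^bsub>H_infinity\<^esub> g \<in> I r"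
          using f g by (simp add: I add H_infinity_closed)
      qed (use sub 0 in auto)
      fix f g assume "f \<in> I r" "g \<in> carrier H_infinity"
      from mult[OF this] show "f \<otimes>\<^bsub>H_infinity\<^esub> g \<in> I r" "g \<otimes>\<^bsub>H_infinity\<^esub> f \<in> I r"
        by (simp_all add: mult.commute)
    qed
    show "I r \<noteq> carrier H_infinity"
    proof
      assume "I r = carrier H_infinity"
      then have "e 0 0 \<in> I r" using dual(1) by simp
      then show False using dual(2)[of 0 0 0] by (auto simp: I)
    qed
    show "closedin M.mtopology (I r)"
      unfolding M.closedin_metric
    proof (intro conjI sub allI impI)
      fix f assume "f \<in> carrier H_infinity - I r"
      then obtain i where f: "f \<in> carrier H_infinity" and i: "i \<le> r" "\<phi> i f \<noteq> 0" by (auto simp: I)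
      \<comment> \<open>A contractive functional with value \<open>\<phi> i f\<close> at
        \<open>f\<close> cannot vanish at a distance less than the modulus of that value.\<close>
      have "disjnt (I r) (M.mball f (cmod (\<phi> i f)))"
        unfolding disjnt_iff
      proof (intro allI notI, elim conjE)
        fix g assume g: "g \<in> I r" "g \<in> M.mball f (cmod (\<phi> i f))"
        then have gc: "g \<in> carrier H_infinity" and "\<phi> i g = 0" using i by (auto simp: I)
        then have "cmod (\<phi> i f) = cmod (\<phi> i (\<lambda>z\<in>disc. f z - g z))" using f by (simp add: minus)
        also have "\<dots> \<le> adist H_infinity f g"
          using bound f gc by (simp add: adist_def H_infinity_minus H_infinity_closed)
        finally show False using g(2) by simp
      qed
      then show "\<exists>d>0. disjnt (I r) (M.mball f d)" using i by (intro exI[of _ "cmod (\<phi> i f)"]) simp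
    qed
    show "\<exists>B. finite B \<and> B \<subseteq> carrier H_infinity \<and>
       (\<forall>f\<in>carrier H_infinity. \<exists>c. f \<ominus>\<^bsub>H_infinity\<^esub> (\<Oplus>\<^bsub>H_infinity\<^esub>b\<in>B. c b \<odot>\<^bsub>H_infinity\<^esub> b) \<in> I r)"
    proof (intro exI conjI ballI)
      show fin: "finite (e r ` {..r})" by simp
      show car: "e r ` {..r} \<subseteq> carrier H_infinity" using dual(1) by auto
      fix f assume f: "f \<in> carrier H_infinity"
      \<comment> \<open>Coefficients are attached to the vectors \<open>b\<close> themselves, not to
        indices. By duality the sum picks out the index \<open>j\<close> with
        \<open>b = e r j\<close>.\<close>
      define c where "c b = (\<Sum>j\<le>r. \<phi> j f * \<phi> j b)" for b
      have c: "c (e r k) = \<phi> k f" if "k \<le> r" for k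
        using that by (simp add: c_def dual(2) if_distrib[of "(*) _"] cong: if_cong)
      have inj: "inj_on (e r) {..r}"
      proof (rule inj_onI)
        fix j k assume "j \<in> {..r}" "k \<in> {..r}" "e r j = e r k"
        then show "j = k" using dual(2)[of j r j] dual(2)[of j r k] by (auto split: if_splits)
      qed
      have *: "(\<Oplus>\<^bsub>H_infinity\<^esub>b\<in>B. c b \<odot>\<^bsub>H_infinity\<^esub> b) \<in> carrier H_infinity \<and>
         \<phi> i (\<Oplus>\<^bsub>H_infinity\<^esub>b\<in>B. c b \<odot>\<^bsub>H_infinity\<^esub> b) = (\<Sum>b\<in>B. c b * \<phi> i b)"
        if "finite B" "B \<subseteq> carrier H_infinity" for B i
        using that
      proof (induction B rule: finite_induct)
        case empty
        then show ?case
          by (simp only: finsum_empty H_infinity_simps sum.empty H_infinity_const zero simp_thms)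
      next
        case (insert b B)
        then have "(\<Oplus>\<^bsub>H_infinity\<^esub>b\<in>insert b B. c b \<odot>\<^bsub>H_infinity\<^esub> b) =
            c b \<odot>\<^bsub>H_infinity\<^esub> b \<oplus>\<^bsub>H_infinity\<^esub> (\<Oplus>\<^bsub>H_infinity\<^esub>b\<in>B. c b \<odot>\<^bsub>H_infinity\<^esub> b)"
          by (intro finsum_insert) (auto simp: H_infinity_closed)
        with insert show ?case
          using H_infinity_closed(4)[of b b "c b"]
          by (simp only: H_infinity_simps) (simp add: H_infinity_closed add smult del: restrict_apply)
      qed
      let ?s = "\<Oplus>\<^bsub>H_infinity\<^esub>b\<in>e r ` {..r}. c b \<odot>\<^bsub>H_infinity\<^esub> b"
      have "\<phi> i ?s = \<phi> i f" if i: "i \<le> r" for i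
      proof -
        have "\<phi> i ?s = (\<Sum>b\<in>e r ` {..r}. c b * \<phi> i b)" using *[OF fin car] by blast
        also have "\<dots> = (\<Sum>j\<le>r. c (e r j) * \<phi> i (e r j))" by (simp add: sum.reindex[OF inj])
        also have "\<dots> = (\<Sum>j\<le>r. if j = i then \<phi> i f else 0)"
          using i by (intro sum.cong refl) (auto simp: c dual(2))
        also have "\<dots> = \<phi> i f" using i by simp
        finally show ?thesis .
      qed
      then show "f \<ominus>\<^bsub>H_infinity\<^esub> ?s \<in> I r"
        using f *[OF fin car] by (simp add: I H_infinity_minus H_infinity_closed minus del: H_infinity_simps)
    qed
    show "I s \<subseteq> I r" if "r \<le> s" for s
      using that by (auto simp: I)
  qed
qed

section \<open>The Taylor filtration\<close>

abbreviation taylor_fps :: "(complex \<Rightarrow> complex) \<Rightarrow> complex fps" where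
  "taylor_fps f \<equiv> Abs_fps (taylor_coeff f)"

text \<open>Derivatives at 0 see only the germ there, so the convention for values outside the disc
  does not affect them.\<close>

lemma taylor_coeff_restrict: "taylor_coeff (\<lambda>z\<in>disc. f z) = taylor_coeff f"
proof -
  have "eventually (\<lambda>z. z \<in> disc) (nhds (0::complex))"
    by (intro eventually_nhds_in_open) auto
  then have "eventually (\<lambda>z. restrict f disc z = f z) (nhds 0)"
    by eventually_elim simp
  then show ?thesis
    unfolding taylor_coeff_def by (intro ext arg_cong2[of _ _ _ _ "(/)"] higher_deriv_cong_ev refl)
qed

lemma taylor_fps_eqI: "f has_fps_expansion F \<Longrightarrow> taylor_fps f = F"
  by (simp add: fps_eq_iff taylor_coeff_eqI)

lemma H_infinity_has_fps_expansion:
  "f \<in> carrier H_infinity \<Longrightarrow> f has_fps_expansion taylor_fps f"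
  by (rule has_fps_expansion_taylor_coeff) (simp add: H_infinity_carrier_iff)

lemma taylor_fps_arith:
  assumes "f \<in> carrier H_infinity" "g \<in> carrier H_infinity"
  shows "taylor_fps (\<lambda>z\<in>disc. f z + g z) = taylor_fps f + taylor_fps g"
    and "taylor_fps (\<lambda>z\<in>disc. f z * g z) = taylor_fps f * taylor_fps g"
    and "taylor_fps (\<lambda>z\<in>disc. c * f z) = fps_const c * taylor_fps f"
    and "taylor_fps (\<lambda>z\<in>disc. c) = fps_const c"
  unfolding taylor_coeff_restrict using assms
  by (auto intro!: taylor_fps_eqI fps_expansion_intros H_infinity_has_fps_expansion)

section \<open>Closed balls of \<open>H_infinity\<close> and division by powers of the
  variable\<close>

lemma H_infinity_entire:
  assumes "h holomorphic_on UNIV"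
  shows "(\<lambda>z\<in>disc. h z) \<in> carrier H_infinity"
proof -
  have "continuous_on (cball 0 1) h"
    using assms holomorphic_on_imp_continuous_on holomorphic_on_subset by blast
  then have "bounded (h ` cball 0 1)"
    by (intro compact_imp_bounded compact_continuous_image) auto
  then obtain C where "\<And>z. z \<in> cball 0 1 \<Longrightarrow> cmod (h z) \<le> C"
    unfolding bounded_iff by blast
  then show ?thesis
    using assms by (intro restrict_in_H_infinity[of _ C]) (auto intro: holomorphic_on_subset)
qed

text \<open>Division by \<open>C\<close> identifies the closed ball with the Schur class, whose
  members are unconstrained outside the disc. The predicate \<open>P\<close> carries the
  interpolation condition, so both theorems transfer by this one statement.\<close>

lemma H_infinity_ball_iff:
  assumes "C > 0"
  shows "(\<exists>f\<in>carrier H_infinity. anorm H_infinity f \<le> C \<and> P f) \<longleftrightarrow>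
    (\<exists>g\<in>schur_class. P (\<lambda>z\<in>disc. of_real C * g z))"
proof
  assume "\<exists>f\<in>carrier H_infinity. anorm H_infinity f \<le> C \<and> P f"
  then obtain f where f: "f \<in> carrier H_infinity" "anorm H_infinity f \<le> C" "P f" by blast
  have "(\<lambda>z\<in>disc. of_real C * (f z / of_real C)) = f"
    using assms by (intro H_infinity_restrict_eqI f) simp
  moreover have "(\<lambda>z. f z / of_real C) holomorphic_on disc"
    using f assms by (intro holomorphic_intros) (auto simp: H_infinity_carrier_iff)
  then have "(\<lambda>z. f z / of_real C) \<in> schur_class"
    using f(2) assms by (simp add: schur_class_def H_infinity_norm_le_iff[OF f(1)] norm_divide)
  ultimately show "\<exists>g\<in>schur_class. P (\<lambda>z\<in>disc. of_real C * g z)"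
    using f(3) by (intro bexI[of _ "\<lambda>z. f z / of_real C"]) simp_all
next
  assume "\<exists>g\<in>schur_class. P (\<lambda>z\<in>disc. of_real C * g z)"
  then obtain g where g: "g \<in> schur_class" "P (\<lambda>z\<in>disc. of_real C * g z)" by blast
  have le: "cmod (of_real C * g z) \<le> C" if "z \<in> disc" for z
    using g(1) that assms by (simp add: schur_class_def norm_mult mult_le_cancel_left1)
  have f: "(\<lambda>z\<in>disc. of_real C * g z) \<in> carrier H_infinity"
    using g(1) by (intro restrict_in_H_infinity[OF _ le] holomorphic_intros) (simp_all add: schur_class_def)
  moreover have "anorm H_infinity (\<lambda>z\<in>disc. of_real C * g z) \<le> C"
    unfolding H_infinity_norm_le_iff[OF f] using le by simp
  ultimately show "\<exists>f\<in>carrier H_infinity. anorm H_infinity f \<le> C \<and> P f" using g(2) by blast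
qed

text \<open>The radius that cannot be scaled to 1: the ball contains only the zero function.\<close>

lemma H_infinity_ball_0_iff:
  "(\<exists>f\<in>carrier H_infinity. anorm H_infinity f \<le> 0 \<and> P f) \<longleftrightarrow> P (\<lambda>z\<in>disc. 0)"
proof -
  have "f = (\<lambda>z\<in>disc. 0)" if "f \<in> carrier H_infinity" "anorm H_infinity f \<le> 0" for f
    using that by (intro H_infinity_restrict_eqI[symmetric]) (auto simp: H_infinity_norm_le_iff)
  moreover have "anorm H_infinity (\<lambda>z\<in>disc. 0) \<le> 0"
    unfolding H_infinity_norm_le_iff[OF H_infinity_const] by simp
  ultimately show ?thesis using H_infinity_const[of 0] by metis
qed

lemma trunc_norm2_scale: "trunc_norm2 n (fps_const c * F) = (cmod c)\<^sup>2 * trunc_norm2 n F"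
  by (simp add: trunc_norm2_def norm_mult power_mult_distrib sum_distrib_left)

lemma trunc_norm2_zero_iff: "trunc_norm2 n F = 0 \<longleftrightarrow> trunc_zero n F"
  by (auto simp: trunc_norm2_def trunc_zero_def sum_nonneg_eq_0_iff)

lemma H_infinity_Caratheodory:
  assumes "0 \<le> C"
  shows "(\<exists>f\<in>carrier H_infinity. anorm H_infinity f \<le> C \<and> trunc_zero n (taylor_fps f - a)) \<longleftrightarrow>
    trunc_bound n C a"
proof (cases "C = 0")
  case True
  have "trunc_zero n (taylor_fps (\<lambda>z\<in>disc. 0) - a) \<longleftrightarrow> trunc_norm2 n a = 0"
    using taylor_fps_arith(4)[OF H_infinity_const[of 0] H_infinity_const[of 0], of 0]
    by (simp add: trunc_norm2_zero_iff) (simp add: trunc_zero_def)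
  also have "\<dots> \<longleftrightarrow> trunc_bound n 0 a"
  proof
    assume "trunc_norm2 n a = 0"
    then have "trunc_norm2 n (a * u) = 0" for u
      unfolding trunc_norm2_zero_iff by (rule trunc_zero_mult)
    then show "trunc_bound n 0 a" by (simp add: trunc_bound_def)
  next
    assume "trunc_bound n 0 a"
    \<comment> \<open>Applied to the series 1, multiplication by \<open>a\<close> returns the
      coefficients of \<open>a\<close>.\<close>
    from this[unfolded trunc_bound_def, rule_format, of 1] show "trunc_norm2 n a = 0"
      using trunc_norm2_nonneg[of n a] by simp
  qed
  finally show ?thesis by (simp only: True H_infinity_ball_0_iff)
next
  case False
  then have C: "C > 0" using assms by simp
  let ?b = "fps_const (1 / of_real C) * a"
  have "trunc_zero n (taylor_fps (\<lambda>z\<in>disc. of_real C * g z) - a) \<longleftrightarrow> trunc_zero n (taylor_fps g - ?b)"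
    if "g \<in> schur_class" for g
  proof -
    have "g has_fps_expansion taylor_fps g"
      using that by (intro has_fps_expansion_taylor_coeff) (simp add: schur_class_def)
    then have "taylor_fps (\<lambda>z\<in>disc. of_real C * g z) = fps_const (of_real C) * taylor_fps g"
      unfolding taylor_coeff_restrict by (intro taylor_fps_eqI fps_expansion_intros)
    moreover have "fps_const (of_real C) * ?b = a"
      using C by (simp add: mult.assoc[symmetric] fps_const_mult)
    ultimately have "taylor_fps (\<lambda>z\<in>disc. of_real C * g z) - a = fps_const (of_real C) * (taylor_fps g - ?b)"
      by (simp only: right_diff_distrib)
    then show ?thesis
      using C trunc_zero_mult_unit[of "fps_const (of_real C)" n "taylor_fps g - ?b"]
      by (simp only: mult.commute[of _ "fps_const (of_real C)"]) simp
  qed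
  then have "(\<exists>f\<in>carrier H_infinity. anorm H_infinity f \<le> C \<and> trunc_zero n (taylor_fps f - a)) \<longleftrightarrow>
      (\<exists>g\<in>schur_class. trunc_zero n (taylor_fps g - ?b))"
    unfolding H_infinity_ball_iff[OF C] by blast
  also have "\<dots> \<longleftrightarrow> trunc_bound n 1 ?b" by (rule Caratheodory_Schur)
  also have "\<dots> \<longleftrightarrow> trunc_bound n C a"
  proof -
    have "trunc_norm2 n (?b * u) = trunc_norm2 n (a * u) / C\<^sup>2" for u
      using C by (simp add: mult.assoc trunc_norm2_scale norm_divide power_divide)
    then show ?thesis using C by (simp add: trunc_bound_def divide_le_eq mult.commute[of _ "C\<^sup>2"])
  qed
  finally show ?thesis .
qed

text \<open>The Cauchy estimate without a contour integral: \<open>f\<close> interpolates its own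
  coefficients, so its Toeplitz matrix is bounded by its norm, and the first column contains the
  coefficient in question.\<close>

lemma cmod_taylor_coeff_le:
  assumes "f \<in> carrier H_infinity"
  shows "cmod (taylor_coeff f i) \<le> anorm H_infinity f"
proof -
  let ?C = "anorm H_infinity f"
  have "trunc_bound (Suc i) ?C (taylor_fps f)"
    using H_infinity_Caratheodory[OF H_infinity_norm_nonneg[OF assms], of "Suc i" "taylor_fps f"] assms
    by (auto simp: trunc_zero_def)
  from this[unfolded trunc_bound_def, rule_format, of 1]
  have "trunc_norm2 (Suc i) (taylor_fps f) \<le> ?C\<^sup>2 * trunc_norm2 (Suc i) 1" by simp
  also have "trunc_norm2 (Suc i) 1 = 1"
    unfolding trunc_norm2_def by (subst sum.lessThan_Suc_shift) simp
  finally have "trunc_norm2 (Suc i) (taylor_fps f) \<le> ?C\<^sup>2" by simp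
  moreover have "(cmod (taylor_coeff f i))\<^sup>2 \<le> trunc_norm2 (Suc i) (taylor_fps f)"
    by (simp add: trunc_norm2_def sum_nonneg)
  ultimately show ?thesis
    by (intro power2_le_imp_le[OF _ H_infinity_norm_nonneg[OF assms]]) simp
qed

lemma H_infinity_divide_ident:
  assumes f: "f \<in> carrier H_infinity" and "f 0 = 0"
  obtains g where "g \<in> carrier H_infinity" "\<And>z. z \<in> disc \<Longrightarrow> f z = z * g z"
proof -
  \<comment> \<open>The added 1 keeps \<open>C\<close> positive when \<open>f\<close> is the zero
    function, as the scaling requires.\<close>
  define C where "C = anorm H_infinity f + 1"
  have C: "C > 0" using H_infinity_norm_nonneg[OF f] by (simp add: C_def)
  have "\<exists>h\<in>carrier H_infinity. anorm H_infinity h \<le> C \<and> h = f" using f by (simp add: C_def)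
  then obtain g where g: "g \<in> schur_class" "(\<lambda>z\<in>disc. of_real C * g z) = f"
    unfolding H_infinity_ball_iff[OF C] by blast
  then have "g 0 = 0" using \<open>f 0 = 0\<close> C by (auto simp: fun_eq_iff dest: spec[of _ 0])
  then obtain h where h: "h \<in> schur_class" "\<And>z. z \<in> disc \<Longrightarrow> g z = z * h z"
    using schur_class_divide_ident[OF g(1)] by blast
  have "\<exists>k\<in>carrier H_infinity. anorm H_infinity k \<le> C \<and> k = (\<lambda>z\<in>disc. of_real C * h z)"
    unfolding H_infinity_ball_iff[OF C] using h(1) by blast
  then have "(\<lambda>z\<in>disc. of_real C * h z) \<in> carrier H_infinity" by blast
  moreover have "f z = z * (\<lambda>z\<in>disc. of_real C * h z) z" if "z \<in> disc" for z
    using that h(2)[OF that] g(2)[symmetric] by simp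
  ultimately show thesis by (rule that)
qed

text \<open>One factor \<open>z\<close> is removed at a time: coefficient \<open>n\<close> of
  \<open>f\<close> is the value at 0 of the quotient found so far, and the Schwarz lemma keeps the
  next quotient bounded.\<close>

lemma H_infinity_divide_power:
  assumes "f \<in> carrier H_infinity" "\<And>i. i < n \<Longrightarrow> taylor_coeff f i = 0"
  shows "\<exists>g\<in>carrier H_infinity. f = (\<lambda>z\<in>disc. z ^ n * g z)"
  using assms(2)
proof (induction n)
  case 0
  have "(\<lambda>z\<in>disc. z ^ 0 * f z) = f" by (intro H_infinity_restrict_eqI assms) simp
  then show ?case using assms(1) by metis
next
  case (Suc n)
  then obtain g where g: "g \<in> carrier H_infinity" "f = (\<lambda>z\<in>disc. z ^ n * g z)"
    using less_SucI by blast
  have "(\<lambda>z. z ^ n * g z) has_fps_expansion fps_X ^ n * taylor_fps g"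
    by (intro fps_expansion_intros H_infinity_has_fps_expansion g)
  then have "taylor_fps f = fps_X ^ n * taylor_fps g"
    unfolding g(2) taylor_coeff_restrict by (rule taylor_fps_eqI)
  then have "fps_nth (taylor_fps f) n = fps_nth (fps_X ^ n * taylor_fps g) n" by simp
  then have "taylor_coeff f n = taylor_coeff g 0" by (simp add: fps_X_power_mult_nth)
  then have "g 0 = 0" using Suc.prems[of n] by (simp add: taylor_coeff_def)
  then obtain h where h: "h \<in> carrier H_infinity" "\<And>z. z \<in> disc \<Longrightarrow> g z = z * h z"
    using H_infinity_divide_ident[OF g(1)] by blast
  have "f = (\<lambda>z\<in>disc. z ^ Suc n * h z)"
    unfolding g(2) restrict_disc_eq_iff by (simp add: h(2) mult_ac)
  with h(1) show ?case by blast
qed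

text \<open>Presents the principal ideal as a joint kernel of functionals, the form that
  \<open>H_infinity_filtration\<close> expects. The content is that the cofactor of the power of
  \<open>z\<close> is again bounded.\<close>

lemma taylor_ideal_eq:
  "taylor_ideal r = {f \<in> carrier H_infinity. \<forall>i\<le>r. taylor_coeff f i = 0}"
proof (intro equalityI subsetI)
  fix f assume "f \<in> taylor_ideal r"
  then obtain g where g: "g \<in> carrier H_infinity" "f = (\<lambda>z\<in>disc. z ^ Suc r * g z)"
    by (auto simp: taylor_ideal_def)
  have "(\<lambda>z\<in>disc. z ^ Suc r) \<in> carrier H_infinity"
    by (intro H_infinity_entire holomorphic_intros)
  from H_infinity_closed(2)[OF this g(1)] have "f \<in> carrier H_infinity"
    unfolding g(2) by (simp cong: restrict_cong)
  moreover have "(\<lambda>z. z ^ Suc r * g z) has_fps_expansion fps_X ^ Suc r * taylor_fps g"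
    by (intro fps_expansion_intros H_infinity_has_fps_expansion g)
  then have "taylor_fps f = fps_X ^ Suc r * taylor_fps g"
    unfolding g(2) taylor_coeff_restrict by (rule taylor_fps_eqI)
  then have "fps_nth (taylor_fps f) i = fps_nth (fps_X ^ Suc r * taylor_fps g) i" for i by simp
  then have "taylor_coeff f i = 0" if "i \<le> r" for i
    using that by (simp add: fps_X_power_mult_nth del: power_Suc)
  ultimately show "f \<in> {f \<in> carrier H_infinity. \<forall>i\<le>r. taylor_coeff f i = 0}" by simp
next
  fix f assume "f \<in> {f \<in> carrier H_infinity. \<forall>i\<le>r. taylor_coeff f i = 0}"
  then have "\<exists>g\<in>carrier H_infinity. f = (\<lambda>z\<in>disc. z ^ Suc r * g z)"
    by (intro H_infinity_divide_power) auto
  then show "f \<in> taylor_ideal r" by (auto simp: taylor_ideal_def)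
qed

lemma taylor_coeff_monomial: "taylor_coeff (\<lambda>z\<in>disc. z ^ j) i = (if i = j then 1 else 0)"
  unfolding taylor_coeff_restrict
  by (simp add: taylor_coeff_eqI[OF has_fps_expansion_fps_X_power])

lemma taylor_filtration: "detection_filtration H_infinity taylor_ideal"
proof (rule H_infinity_filtration[where \<phi> = "\<lambda>i f. taylor_coeff f i" and e = "\<lambda>r j. \<lambda>z\<in>disc. z ^ j"])
  show "taylor_ideal r = {f \<in> carrier H_infinity. \<forall>i\<le>r. taylor_coeff f i = 0}" for r
    by (rule taylor_ideal_eq)
  fix f assume f: "f \<in> carrier H_infinity"
  show "cmod (taylor_coeff f i) \<le> anorm H_infinity f" for i
    by (rule cmod_taylor_coeff_le[OF f])
  show "taylor_coeff (\<lambda>z\<in>disc. c * f z) i = c * taylor_coeff f i" for i c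
    using arg_cong[OF taylor_fps_arith(3)[OF f f], of "\<lambda>F. fps_nth F i"] by simp
  fix g assume g: "g \<in> carrier H_infinity"
  show "taylor_coeff (\<lambda>z\<in>disc. f z + g z) i = taylor_coeff f i + taylor_coeff g i" for i
    using arg_cong[OF taylor_fps_arith(1)[OF f g], of "\<lambda>F. fps_nth F i"] by simp
next
  fix r f g assume f: "f \<in> taylor_ideal r" and g: "g \<in> carrier H_infinity"
  then have fc: "f \<in> carrier H_infinity" and "trunc_zero (Suc r) (taylor_fps f)"
    by (auto simp: taylor_ideal_eq trunc_zero_def)
  then have "trunc_zero (Suc r) (taylor_fps (\<lambda>z\<in>disc. f z * g z))"
    using trunc_zero_mult taylor_fps_arith(2)[OF fc g] by metis
  then show "(\<lambda>z\<in>disc. f z * g z) \<in> taylor_ideal r"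
    using H_infinity_closed(2)[OF fc g] by (simp add: taylor_ideal_eq trunc_zero_def less_Suc_eq_le)
qed (auto simp: taylor_coeff_monomial intro!: H_infinity_entire holomorphic_intros)

section \<open>Truncated shifts and Toeplitz matrices\<close>

lemma truncated_shift_power:
  "truncated_shift r ^\<^sub>m k = Matrix.mat (Suc r) (Suc r) (\<lambda>(i, j). if i = j + k then 1 else 0)"
proof (induction k)
  case 0
  show ?case by (rule eq_matI) (auto simp: truncated_shift_def)
next
  case (Suc k)
  show ?case
  proof (rule eq_matI)
    fix i j
    assume "i < dim_row (Matrix.mat (Suc r) (Suc r) (\<lambda>(i, j). if i = j + Suc k then 1 else 0 :: complex))"
      "j < dim_col (Matrix.mat (Suc r) (Suc r) (\<lambda>(i, j). if i = j + Suc k then 1 else 0 :: complex))"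
    then have ij: "i < Suc r" "j < Suc r" by auto
    have "truncated_shift r ^\<^sub>m Suc k =
        Matrix.mat (Suc r) (Suc r) (\<lambda>(i, j). if i = j + k then 1 else 0) * truncated_shift r"
      by (simp add: Suc)
    then have "(truncated_shift r ^\<^sub>m Suc k) $$ (i, j) =
        (\<Sum>m\<in>{0..<Suc r}. (if i = m + k then 1 else 0) * (if m = Suc j then 1 else 0))"
      using ij by (simp add: truncated_shift_def scalar_prod_def del: sum.op_ivl_Suc pow_mat.simps)
    also have "\<dots> = (\<Sum>m\<in>{0..<Suc r}. if m = Suc j then (if i = Suc j + k then 1 else 0) else 0)"
      by (intro sum.cong refl) auto
    also have "\<dots> = (if i = j + Suc k then 1 else 0)"
      using ij by (subst sum.delta) auto
    finally show "(truncated_shift r ^\<^sub>m Suc k) $$ (i, j) =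
        Matrix.mat (Suc r) (Suc r) (\<lambda>(i, j). if i = j + Suc k then 1 else 0) $$ (i, j)"
      using ij by simp
  qed (simp_all add: truncated_shift_def)
qed

lemma toeplitz_eq:
  "toeplitz r a = Matrix.mat (Suc r) (Suc r) (\<lambda>(i, j). if j \<le> i then a (i - j) else 0)"
proof -
  let ?R = "ring_mat TYPE(complex) (Suc r) ()"
  interpret ring ?R by (rule ring_mat)
  have summand: "a j \<cdot>\<^sub>m (truncated_shift r ^\<^sub>m j) =
      Matrix.mat (Suc r) (Suc r) (\<lambda>(i, k). if i = k + j then a j else 0)" for j
    unfolding truncated_shift_power by (auto intro!: eq_matI)
  let ?M = "\<lambda>j. Matrix.mat (Suc r) (Suc r) (\<lambda>(i, k). if i = k + j then a j else 0)"
  have car: "?M j \<in> carrier ?R" for j by (simp add: ring_mat_simps)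
  \<comment> \<open>Induction on the number of summands with the size fixed; for
    \<open>n = r\<close> the condition \<open>i - j \<le> n\<close> holds for all positions in the
    matrix.\<close>
  have "(\<Oplus>\<^bsub>?R\<^esub> j\<in>{..n}. ?M j) =
      Matrix.mat (Suc r) (Suc r) (\<lambda>(i, j). if j \<le> i \<and> i - j \<le> n then a (i - j) else 0)" for n
  proof (induction n)
    case 0
    have "(\<Oplus>\<^bsub>?R\<^esub> j\<in>{..0}. ?M j) = ?M 0" using car by (intro finsum_0 Pi_I)
    also have "\<dots> = Matrix.mat (Suc r) (Suc r) (\<lambda>(i, j). if j \<le> i \<and> i - j \<le> 0 then a (i - j) else 0)"
      by (rule eq_matI) auto
    finally show ?case .
  next
    case (Suc n)
    have "(\<Oplus>\<^bsub>?R\<^esub> j\<in>{..Suc n}. ?M j) = ?M (Suc n) + (\<Oplus>\<^bsub>?R\<^esub> j\<in>{..n}. ?M j)"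
      using finsum_Suc[of ?M n] car by (simp add: ring_mat_simps)
    also have "\<dots> = Matrix.mat (Suc r) (Suc r) (\<lambda>(i, j). if j \<le> i \<and> i - j \<le> Suc n then a (i - j) else 0)"
      unfolding Suc by (rule eq_matI) (auto simp: le_Suc_eq)
    finally show ?case .
  qed
  then show ?thesis unfolding toeplitz_def summand by (auto intro!: eq_matI)
qed

lemma toeplitz_dim [simp]: "dim_row (toeplitz r a) = Suc r" "dim_col (toeplitz r a) = Suc r"
  by (simp_all add: toeplitz_eq)

lemma toeplitz_index: "i \<le> r \<Longrightarrow> j \<le> r \<Longrightarrow> toeplitz r a $$ (i, j) = (if j \<le> i then a (i - j) else 0)"
  by (simp add: toeplitz_eq)

lemma toeplitz_eq_iff: "toeplitz r a = toeplitz r b \<longleftrightarrow> (\<forall>k\<le>r. a k = b k)"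
proof
  assume "toeplitz r a = toeplitz r b"
  then show "\<forall>k\<le>r. a k = b k" using toeplitz_index[of _ r 0] by (metis diff_zero le0)
qed (auto simp: toeplitz_eq intro!: eq_matI)

text \<open>A row of the Toeplitz matrix against a vector is a coefficient of a Cauchy product. This
  is the bridge between the matrices and multiplication of truncated series.\<close>

lemma toeplitz_convolution:
  assumes "i < n"
  shows "(\<Sum>k\<in>{0..<n}. (if k \<le> i then a (i - k) else 0) * b k) = fps_nth (Abs_fps a * Abs_fps b :: complex fps) i"
proof -
  have "(\<Sum>k\<in>{0..<n}. (if k \<le> i then a (i - k) else 0) * b k) = (\<Sum>k\<in>{0..i}. a (i - k) * b k)"
    using assms by (intro sum.mono_neutral_cong_right) auto
  also have "\<dots> = (\<Sum>k\<in>{0..i}. a k * b (i - k))"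
    by (rule sum.reindex_bij_witness[of _ "\<lambda>k. i - k" "\<lambda>k. i - k"]) auto
  finally show ?thesis by (simp add: fps_mult_nth)
qed

lemma toeplitz_mult:
  "toeplitz r a * toeplitz r b = toeplitz r (fps_nth (Abs_fps a * Abs_fps b))"
proof (rule eq_matI)
  fix i j assume "i < dim_row (toeplitz r (fps_nth (Abs_fps a * Abs_fps b)))"
    "j < dim_col (toeplitz r (fps_nth (Abs_fps a * Abs_fps b)))"
  then have ij: "i < Suc r" "j < Suc r" by auto
  \<comment> \<open>Column \<open>j\<close> of the second matrix: the sequence \<open>b\<close>
    moved down by \<open>j\<close>, which as a series is multiplication by
    \<open>fps_X ^ j\<close>.\<close>
  let ?b = "\<lambda>k. if j \<le> k then b (k - j) else 0"
  have b: "Abs_fps ?b = fps_X ^ j * Abs_fps b"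
    by (rule fps_ext) (simp add: fps_X_power_mult_nth)
  have "(toeplitz r a * toeplitz r b) $$ (i, j) = (\<Sum>k\<in>{0..<Suc r}. (if k \<le> i then a (i - k) else 0) * ?b k)"
    using ij by (simp add: scalar_prod_def toeplitz_eq del: sum.op_ivl_Suc)
  also have "\<dots> = fps_nth (Abs_fps a * Abs_fps ?b) i" by (rule toeplitz_convolution[OF ij(1)])
  also have "\<dots> = fps_nth (fps_X ^ j * (Abs_fps a * Abs_fps b)) i"
    by (simp only: b mult.left_commute)
  also have "\<dots> = toeplitz r (fps_nth (Abs_fps a * Abs_fps b)) $$ (i, j)"
    using ij by (simp add: fps_X_power_mult_nth toeplitz_eq not_le)
  finally show "(toeplitz r a * toeplitz r b) $$ (i, j) = toeplitz r (fps_nth (Abs_fps a * Abs_fps b)) $$ (i, j)" .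
qed simp_all

section \<open>Operator norms of Toeplitz matrices\<close>

lemma euclidean_norm_square:
  assumes "dim_vec v = Suc r"
  shows "(euclidean_norm v)\<^sup>2 = trunc_norm2 (Suc r) (Abs_fps (vec_index v))"
  using assms by (simp add: euclidean_norm_def L2_set_def trunc_norm2_def sum_nonneg del: sum.lessThan_Suc)

lemma euclidean_norm_nonneg: "0 \<le> euclidean_norm v"
  by (simp add: euclidean_norm_def)

text \<open>Beyond the dimension \<open>vec_index v\<close> is unspecified, but coefficients of a
  product below \<open>Suc r\<close> involve only coefficients of the factors below
  \<open>Suc r\<close>.\<close>

lemma euclidean_norm_toeplitz:
  assumes "dim_vec v = Suc r"
  shows "(euclidean_norm (toeplitz r a *\<^sub>v v))\<^sup>2 = trunc_norm2 (Suc r) (Abs_fps a * Abs_fps (vec_index v))"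
proof -
  have "vec_index (toeplitz r a *\<^sub>v v) i = fps_nth (Abs_fps a * Abs_fps (vec_index v)) i" if "i < Suc r" for i
  proof -
    have "vec_index (toeplitz r a *\<^sub>v v) i =
        (\<Sum>k\<in>{0..<Suc r}. (if k \<le> i then a (i - k) else 0) * vec_index v k)"
      using that assms by (simp add: scalar_prod_def toeplitz_eq del: sum.op_ivl_Suc)
    then show ?thesis by (simp only: toeplitz_convolution[OF that])
  qed
  then show ?thesis by (simp add: euclidean_norm_square trunc_norm2_def del: sum.lessThan_Suc)
qed

lemma H_infinity_taylor_surj:
  "\<exists>f\<in>carrier H_infinity. \<forall>k\<le>r. taylor_coeff f k = a k"
proof -
  let ?p = "\<lambda>z. \<Sum>k\<le>r. a k * z ^ k"
  have "?p has_fps_expansion (\<Sum>k\<le>r. fps_const (a k) * fps_X ^ k)"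
    by (intro fps_expansion_intros)
  from taylor_coeff_eqI[OF this]
  have "taylor_coeff (\<lambda>z\<in>disc. ?p z) i = (\<Sum>k\<le>r. if k = i then a i else 0)" for i
    unfolding taylor_coeff_restrict by (simp add: fps_sum_nth if_distrib[of "(*) _"] cong: if_cong)
  then have "taylor_coeff (\<lambda>z\<in>disc. ?p z) i = a i" if "i \<le> r" for i
    using that by simp
  moreover have "(\<lambda>z\<in>disc. ?p z) \<in> carrier H_infinity"
    by (intro H_infinity_entire holomorphic_intros)
  ultimately show ?thesis by blast
qed

text \<open>A polynomial has the prescribed coefficients, and its sup norm on the disc is a valid
  \<open>K\<close>. This bounds the set whose supremum is \<open>operator_norm\<close>.\<close>

lemma trunc_bound_exists: "\<exists>K\<ge>0. trunc_bound n K a"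
proof -
  obtain f where f: "f \<in> carrier H_infinity" "\<forall>k\<le>n. taylor_coeff f k = fps_nth a k"
    using H_infinity_taylor_surj by blast
  then have "trunc_zero n (taylor_fps f - a)" by (simp add: trunc_zero_def)
  then show ?thesis
    using H_infinity_Caratheodory[OF H_infinity_norm_nonneg[OF f(1)], of n a] f(1)
      H_infinity_norm_nonneg[OF f(1)] by blast
qed

lemma euclidean_norm_toeplitz_le:
  assumes "trunc_bound (Suc r) K (Abs_fps a)" "0 \<le> K" "v \<in> carrier_vec (Suc r)" "euclidean_norm v \<le> 1"
  shows "euclidean_norm (toeplitz r a *\<^sub>v v) \<le> K"
proof -
  have v: "dim_vec v = Suc r" using assms(3) by simp
  have "(euclidean_norm (toeplitz r a *\<^sub>v v))\<^sup>2 \<le> K\<^sup>2 * (euclidean_norm v)\<^sup>2"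
    using assms(1) by (simp only: euclidean_norm_toeplitz[OF v] euclidean_norm_square[OF v] trunc_bound_def)
  also have "\<dots> \<le> K\<^sup>2 * 1"
    using assms(4) by (intro mult_left_mono power_le_one euclidean_norm_nonneg) auto
  finally show ?thesis by (intro power2_le_imp_le[OF _ assms(2)]) simp
qed

lemma operator_norm_toeplitz_upper:
  assumes "v \<in> carrier_vec (Suc r)" "euclidean_norm v \<le> 1"
  shows "euclidean_norm (toeplitz r a *\<^sub>v v) \<le> operator_norm (toeplitz r a)"
proof -
  obtain K where K: "K \<ge> 0" "trunc_bound (Suc r) K (Abs_fps a)" using trunc_bound_exists by blast
  show ?thesis
    unfolding operator_norm_def
  proof (rule cSUP_upper)
    show "bdd_above ((\<lambda>v. euclidean_norm (toeplitz r a *\<^sub>v v)) `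
        {v \<in> carrier_vec (dim_col (toeplitz r a)). euclidean_norm v \<le> 1})"
      using euclidean_norm_toeplitz_le[OF K(2,1)] by (intro bdd_aboveI2[of _ _ K]) simp
  qed (use assms in simp)
qed

lemma euclidean_norm_zero: "euclidean_norm (0\<^sub>v n) = 0"
  by (simp add: euclidean_norm_def L2_set_def)

lemma operator_norm_toeplitz_nonneg: "0 \<le> operator_norm (toeplitz r a)"
  using operator_norm_toeplitz_upper[of "0\<^sub>v (Suc r)" r a] euclidean_norm_nonneg
  by (rule order_trans[rotated]) (simp_all add: euclidean_norm_zero)

text \<open>The operator norm is a supremum over the unit ball, whereas \<open>trunc_bound\<close>
  is a homogeneous inequality; normalising \<open>u\<close> passes from one to the other, apart from
  a \<open>u\<close> whose truncation is zero.\<close>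

lemma operator_norm_toeplitz_le_iff:
  assumes "0 \<le> C"
  shows "operator_norm (toeplitz r a) \<le> C \<longleftrightarrow> trunc_bound (Suc r) C (Abs_fps a)"
proof
  assume "trunc_bound (Suc r) C (Abs_fps a)"
  then show "operator_norm (toeplitz r a) \<le> C"
    unfolding operator_norm_def using assms
    by (intro cSUP_least euclidean_norm_toeplitz_le) (auto simp: euclidean_norm_zero intro!: exI[of _ "0\<^sub>v (Suc r)"])
next
  assume le: "operator_norm (toeplitz r a) \<le> C"
  let ?N = "trunc_norm2 (Suc r)"
  \<comment> \<open>Replacing \<open>u\<close> by the vector of its first \<open>Suc r\<close>
    coefficients changes \<open>Abs_fps a * u\<close> only above degree \<open>r\<close>.\<close>
  have unit: "?N (Abs_fps a * u) \<le> C\<^sup>2" if u: "?N u \<le> 1" for u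
  proof -
    define v where "v = Matrix.vec (Suc r) (fps_nth u)"
    have z: "trunc_zero (Suc r) (u - Abs_fps (vec_index v))" by (simp add: trunc_zero_def v_def)
    have v: "v \<in> carrier_vec (Suc r)" "dim_vec v = Suc r" by (simp_all add: v_def)
    have "(euclidean_norm v)\<^sup>2 \<le> 1\<^sup>2" using u trunc_norm2_cong[OF z] euclidean_norm_square[OF v(2)] by simp
    then have "euclidean_norm v \<le> 1" by (rule power2_le_imp_le) simp
    then have "euclidean_norm (toeplitz r a *\<^sub>v v) \<le> C"
      using operator_norm_toeplitz_upper[OF v(1)] le by (meson order_trans)
    then have "(euclidean_norm (toeplitz r a *\<^sub>v v))\<^sup>2 \<le> C\<^sup>2"
      by (intro power_mono euclidean_norm_nonneg)
    moreover have "trunc_zero (Suc r) (Abs_fps a * u - Abs_fps a * Abs_fps (vec_index v))"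
      using trunc_zero_mult[OF z, of "Abs_fps a"] by (simp add: right_diff_distrib mult.commute)
    ultimately show ?thesis
      using euclidean_norm_toeplitz[OF v(2)] by (simp add: trunc_norm2_cong)
  qed
  show "trunc_bound (Suc r) C (Abs_fps a)"
    unfolding trunc_bound_def
  proof
    fix u
    show "?N (Abs_fps a * u) \<le> C\<^sup>2 * ?N u"
    proof (cases "?N u = 0")
      case True
      then have "trunc_zero (Suc r) (Abs_fps a * u)"
        using trunc_zero_mult[of "Suc r" u "Abs_fps a"] by (simp add: trunc_norm2_zero_iff mult.commute)
      then show ?thesis using True by (simp add: trunc_norm2_zero_iff[symmetric])
    next
      case False
      define s where "s = sqrt (?N u)"
      have s: "s > 0" "s\<^sup>2 = ?N u" using False trunc_norm2_nonneg[of "Suc r" u] by (simp_all add: s_def)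
      have scale: "?N (fps_const (1 / of_real s) * F) = ?N F / s\<^sup>2" for F
        using s(1) by (simp add: trunc_norm2_scale norm_divide power_divide)
      have "?N (Abs_fps a * (fps_const (1 / of_real s) * u)) \<le> C\<^sup>2"
        using s by (intro unit) (simp add: scale)
      then have "?N (fps_const (1 / of_real s) * (Abs_fps a * u)) \<le> C\<^sup>2"
        by (simp only: mult.left_commute)
      then have "?N (Abs_fps a * u) / s\<^sup>2 \<le> C\<^sup>2" by (simp only: scale)
      then show ?thesis using s(1) by (simp add: pos_divide_le_eq s(2)[symmetric])
    qed
  qed
qed

section \<open>The Taylor quotients as Toeplitz algebras\<close>

lemma toeplitz_taylor_eq_iff:
  "toeplitz r (taylor_coeff f) = toeplitz r (taylor_coeff g) \<longleftrightarrow>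
    trunc_zero (Suc r) (taylor_fps f - taylor_fps g)"
  by (auto simp: toeplitz_eq_iff trunc_zero_def less_Suc_eq_le)

lemma toeplitz_taylor_hom:
  "(\<lambda>f. toeplitz r (taylor_coeff f)) \<in> Ring.ring_hom H_infinity (toeplitz_algebra r)"
proof (rule ring_hom_memI)
  fix f g assume fg: "f \<in> carrier H_infinity" "g \<in> carrier H_infinity"
  have "taylor_coeff (\<lambda>z\<in>disc. f z * g z) = fps_nth (taylor_fps f * taylor_fps g)"
    using taylor_fps_arith(2)[OF fg] by (metis fps_nth_Abs_fps ext)
  then show "toeplitz r (taylor_coeff (f \<otimes>\<^bsub>H_infinity\<^esub> g)) =
      toeplitz r (taylor_coeff f) \<otimes>\<^bsub>toeplitz_algebra r\<^esub> toeplitz r (taylor_coeff g)"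
    by (simp add: toeplitz_algebra_def toeplitz_mult)
  have "taylor_coeff (\<lambda>z\<in>disc. f z + g z) k = taylor_coeff f k + taylor_coeff g k" for k
    using arg_cong[OF taylor_fps_arith(1)[OF fg], of "\<lambda>F. fps_nth F k"] by simp
  then show "toeplitz r (taylor_coeff (f \<oplus>\<^bsub>H_infinity\<^esub> g)) =
      toeplitz r (taylor_coeff f) \<oplus>\<^bsub>toeplitz_algebra r\<^esub> toeplitz r (taylor_coeff g)"
    by (auto simp: toeplitz_algebra_def toeplitz_eq intro!: eq_matI)
next
  have "taylor_coeff (\<lambda>z\<in>disc. 1) k = (if k = 0 then 1 else 0)" for k
    using taylor_coeff_monomial[of 0 k] by simp
  then show "toeplitz r (taylor_coeff \<one>\<^bsub>H_infinity\<^esub>) = \<one>\<^bsub>toeplitz_algebra r\<^esub>"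
    by (auto simp: toeplitz_algebra_def toeplitz_eq intro!: eq_matI)
qed (simp add: toeplitz_algebra_def)

lemma toeplitz_quotient_iso:
  defines "\<Phi> \<equiv> \<lambda>r X. the_elem ((\<lambda>f. toeplitz r (taylor_coeff f)) ` X)"
  shows "\<Phi> r \<in> isometric_iso (quotient_algebra H_infinity (taylor_ideal r)) (toeplitz_algebra r)"
    and "\<And>f. f \<in> carrier H_infinity \<Longrightarrow>
      \<Phi> r (taylor_ideal r +>\<^bsub>H_infinity\<^esub> f) = toeplitz r (taylor_coeff f)"
proof -
  let ?\<Psi> = "\<lambda>f. toeplitz r (taylor_coeff f)"
  have surj: "?\<Psi> ` carrier H_infinity = carrier (toeplitz_algebra r)"
  proof -
    have "toeplitz r a \<in> ?\<Psi> ` carrier H_infinity" for a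
      using H_infinity_taylor_surj[of r a] by (auto simp: image_iff toeplitz_eq_iff) metis
    then show ?thesis by (auto simp: toeplitz_algebra_def)
  qed
  have smult: "?\<Psi> (c \<odot>\<^bsub>H_infinity\<^esub> f) = c \<odot>\<^bsub>toeplitz_algebra r\<^esub> ?\<Psi> f"
    if "f \<in> carrier H_infinity" for c f
  proof -
    have "taylor_coeff (\<lambda>z\<in>disc. c * f z) k = c * taylor_coeff f k" for k
      using arg_cong[OF taylor_fps_arith(3)[OF that that], of "\<lambda>F. fps_nth F k"] by simp
    then show ?thesis by (auto simp: toeplitz_algebra_def toeplitz_eq intro!: eq_matI)
  qed
  have ker: "?\<Psi> f = ?\<Psi> g \<longleftrightarrow> f \<ominus>\<^bsub>H_infinity\<^esub> g \<in> taylor_ideal r"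
    if fg: "f \<in> carrier H_infinity" "g \<in> carrier H_infinity" for f g
  proof -
    have "(\<lambda>z. f z - g z) has_fps_expansion taylor_fps f - taylor_fps g"
      by (intro fps_expansion_intros H_infinity_has_fps_expansion fg)
    then have "taylor_coeff (\<lambda>z\<in>disc. f z - g z) i = taylor_coeff f i - taylor_coeff g i" for i
      unfolding taylor_coeff_restrict by (simp add: taylor_coeff_eqI)
    then show ?thesis
      using H_infinity_closed(3)[OF fg] fg
      by (simp add: taylor_ideal_eq H_infinity_minus toeplitz_eq_iff)
  qed
  \<comment> \<open>Both sides are the contractivity condition \<open>trunc_bound\<close>: the left
    by homogeneity of the operator norm, the right by the Caratheodory--Schur theorem.\<close>
  have norm: "anorm (toeplitz_algebra r) (?\<Psi> f) \<le> C \<longleftrightarrow>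
      (\<exists>g\<in>carrier H_infinity. anorm H_infinity g \<le> C \<and> ?\<Psi> g = ?\<Psi> f)"
    if "f \<in> carrier H_infinity" "0 \<le> C" for f C
    unfolding toeplitz_taylor_eq_iff H_infinity_Caratheodory[OF that(2)]
    by (simp add: toeplitz_algebra_def operator_norm_toeplitz_le_iff[OF that(2)])
  note iso = quotient_algebra_isometric_iso[OF H_infinity_ring
      detection_filtration.two_sided_ideal[OF taylor_filtration] _ H_infinity_norm_nonneg
      toeplitz_taylor_hom surj smult ker _ norm]
  show "\<Phi> r \<in> isometric_iso (quotient_algebra H_infinity (taylor_ideal r)) (toeplitz_algebra r)"
    unfolding \<Phi>_def
    by (rule iso(1)) (simp_all add: H_infinity_closed toeplitz_algebra_def operator_norm_toeplitz_nonneg)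
  show "\<Phi> r (taylor_ideal r +>\<^bsub>H_infinity\<^esub> f) = toeplitz r (taylor_coeff f)"
    if "f \<in> carrier H_infinity" for f
    unfolding \<Phi>_def
    by (rule iso(2)) (simp_all add: H_infinity_closed toeplitz_algebra_def operator_norm_toeplitz_nonneg that)
qed

lemma leading_block_toeplitz: "r \<le> s \<Longrightarrow> leading_block r (toeplitz s a) = toeplitz r a"
  by (auto simp: leading_block_def toeplitz_eq intro!: eq_matI)

section \<open>The vanishing filtration\<close>

lemma psd_on_scale:
  fixes \<kappa> :: real
  assumes "\<kappa> > 0"
  shows "psd_on J (\<lambda>i j. of_real \<kappa> * P i j) \<longleftrightarrow> psd_on J P"
proof -
  have "(\<Sum>i\<in>J. \<Sum>j\<in>J. c i * cnj (c j) * (of_real \<kappa> * P i j)) =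
      of_real \<kappa> * (\<Sum>i\<in>J. \<Sum>j\<in>J. c i * cnj (c j) * P i j)" for c
    by (simp add: sum_distrib_left mult_ac)
  moreover have "0 \<le> of_real \<kappa> * z \<longleftrightarrow> 0 \<le> z" for z :: complex
    using assms by (auto simp: less_eq_complex_def zero_le_mult_iff)
  ultimately show ?thesis by (simp only: psd_on_def)
qed

text \<open>Dividing the values by \<open>C\<close> multiplies the kernel by the positive constant
  \<open>1 / C^2\<close>, which positivity ignores. For \<open>C = 0\<close> the diagonal entries
  are nonpositive, so positivity forces every value to be 0.\<close>

lemma H_infinity_Pick:
  assumes "0 \<le> C" "finite J" "inj_on l J" "l ` J \<subseteq> disc"
  shows "(\<exists>f\<in>carrier H_infinity. anorm H_infinity f \<le> C \<and> (\<forall>i\<in>J. f (l i) = w i)) \<longleftrightarrow>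
    psd_on J (\<lambda>i j. ((of_real C)\<^sup>2 - w i * cnj (w j)) / (1 - l i * cnj (l j)))"
proof (cases "C = 0")
  case True
  have l: "cmod (l i) < 1" if "i \<in> J" for i using assms(4) that by auto
  have "(\<forall>i\<in>J. (\<lambda>z\<in>disc. 0) (l i) = w i) \<longleftrightarrow> (\<forall>i\<in>J. w i = 0)" using l by auto
  also have "\<dots> \<longleftrightarrow> psd_on J (\<lambda>i j. (0\<^sup>2 - w i * cnj (w j)) / (1 - l i * cnj (l j)))"
  proof
    assume "\<forall>i\<in>J. w i = 0"
    then show "psd_on J (\<lambda>i j. (0\<^sup>2 - w i * cnj (w j)) / (1 - l i * cnj (l j)))"
      by (simp add: psd_on_def)
  next
    assume psd: "psd_on J (\<lambda>i j. (0\<^sup>2 - w i * cnj (w j)) / (1 - l i * cnj (l j)))"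
    show "\<forall>i\<in>J. w i = 0"
    proof
      fix i assume i: "i \<in> J"
      have "(0\<^sup>2 - w i * cnj (w i)) / (1 - l i * cnj (l i)) =
          of_real ((0 - (cmod (w i))\<^sup>2) / (1 - (cmod (l i))\<^sup>2))"
        by (simp only: of_real_divide of_real_diff of_real_1 of_real_0 complex_norm_square) simp
      then have "0 \<le> (0 - (cmod (w i))\<^sup>2) / (1 - (cmod (l i))\<^sup>2)"
        using psd_on_diagonal[OF psd assms(2) i] by (simp only: less_eq_complex_def) simp
      moreover have "1 - (cmod (l i))\<^sup>2 > 0" using l[OF i] by (simp add: abs_square_less_1)
      ultimately show "w i = 0" by (simp add: divide_le_0_iff)
    qed
  qed
  finally show ?thesis by (simp only: True H_infinity_ball_0_iff of_real_0)
next
  case False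
  then have C: "C > 0" using assms(1) by simp
  have l: "cmod (l i) < 1" if "i \<in> J" for i using assms(4) that by auto
  have "(\<forall>i\<in>J. (\<lambda>z\<in>disc. of_real C * g z) (l i) = w i) \<longleftrightarrow> (\<forall>i\<in>J. g (l i) = w i / of_real C)" for g
    using l C by (auto simp: field_simps)
  then have "(\<exists>f\<in>carrier H_infinity. anorm H_infinity f \<le> C \<and> (\<forall>i\<in>J. f (l i) = w i)) \<longleftrightarrow>
      (\<exists>g\<in>schur_class. \<forall>i\<in>J. g (l i) = w i / of_real C)"
    unfolding H_infinity_ball_iff[OF C] by blast
  also have "\<dots> \<longleftrightarrow> psd_on J (pick_kernel l (\<lambda>i. w i / of_real C))"
    by (rule Nevanlinna_Pick[OF assms(2-4)])
  also have "\<dots> \<longleftrightarrow> psd_on J (\<lambda>i j. of_real (C\<^sup>2) * pick_kernel l (\<lambda>i. w i / of_real C) i j)"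
    using C by (intro psd_on_scale[symmetric]) simp
  also have "\<dots> \<longleftrightarrow> psd_on J (\<lambda>i j. ((of_real C)\<^sup>2 - w i * cnj (w j)) / (1 - l i * cnj (l j)))"
    using C by (intro psd_on_cong) (simp add: pick_kernel_def right_diff_distrib power2_eq_square)
  finally show ?thesis .
qed

section \<open>Pick matrices and the norm of the interpolation algebra\<close>

lemma positive_semidefinite_iff:
  "positive_semidefinite (Matrix.mat n n (\<lambda>(i, j). P i j)) \<longleftrightarrow> psd_on {..<n} P"
proof -
  \<comment> \<open>The scalar product conjugates the coefficient of the row index,
    \<open>psd_on\<close> that of the column index; hence test vectors correspond by
    conjugation.\<close>
  have quad: "(Matrix.mat n n (\<lambda>(i, j). P i j) *\<^sub>v v) \<bullet>c v =
      (\<Sum>i<n. \<Sum>j<n. cnj (vec_index v i) * cnj (cnj (vec_index v j)) * P i j)"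
    if "v \<in> carrier_vec n" for v
    using that by (simp add: scalar_prod_def atLeast0LessThan sum_distrib_left mult_ac)
  show ?thesis
  proof
    assume L: "positive_semidefinite (Matrix.mat n n (\<lambda>(i, j). P i j))"
    show "psd_on {..<n} P"
      unfolding psd_on_def
    proof
      fix c
      define v where "v = Matrix.vec n (\<lambda>i. cnj (c i))"
      have v: "v \<in> carrier_vec n" by (simp add: v_def)
      then have "0 \<le> (Matrix.mat n n (\<lambda>(i, j). P i j) *\<^sub>v v) \<bullet>c v"
        using L by (simp add: positive_semidefinite_def)
      then show "0 \<le> (\<Sum>i<n. \<Sum>j<n. c i * cnj (c j) * P i j)"
        unfolding quad[OF v] by (simp add: v_def)
    qed
  next
    assume R: "psd_on {..<n} P"
    show "positive_semidefinite (Matrix.mat n n (\<lambda>(i, j). P i j))"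
      unfolding positive_semidefinite_def
    proof (intro conjI ballI)
      fix v :: "complex Matrix.vec"
      assume "v \<in> carrier_vec (dim_row (Matrix.mat n n (\<lambda>(i, j). P i j)))"
      then have v: "v \<in> carrier_vec n" by simp
      show "0 \<le> (Matrix.mat n n (\<lambda>(i, j). P i j) *\<^sub>v v) \<bullet>c v"
        unfolding quad[OF v] using R[unfolded psd_on_def, rule_format, of "\<lambda>i. cnj (vec_index v i)"] .
    qed simp
  qed
qed

lemma positive_semidefinite_pick_matrix_iff:
  "positive_semidefinite (pick_matrix l r C w) \<longleftrightarrow> psd_on {..<Suc r}
    (\<lambda>i j. ((of_real C)\<^sup>2 - vec_index w i * cnj (vec_index w j)) / (1 - l i * cnj (l j)))"
  unfolding pick_matrix_def by (rule positive_semidefinite_iff)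

text \<open>The quadratic forms are continuous in \<open>C\<close>; with division written as
  multiplication by an inverse, the denominators are constant factors. Closedness is what lets the
  infimum defining the norm be attained.\<close>

lemma closed_positive_semidefinite_pick_matrix:
  "closed {C. positive_semidefinite (pick_matrix l r C w)}"
  unfolding positive_semidefinite_pick_matrix_iff psd_on_def less_eq_complex_def divide_inverse
  by (intro closed_Collect_all closed_Collect_conj closed_Collect_le closed_Collect_eq continuous_intros)

lemma vec_value_tuple_eq_iff:
  "value_tuple l r f = value_tuple l r g \<longleftrightarrow> (\<forall>i\<in>{..<Suc r}. f (l i) = g (l i))"
  by (auto simp: value_tuple_def vec_eq_iff)

locale interpolation_nodes =
  fixes l :: "nat \<Rightarrow> complex"
  assumes in_disc: "l i \<in> disc" and inj: "inj l"
begin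

text \<open>Reads positivity as the existence of a preimage in a closed ball, the shape that
  \<open>quotient_algebra_isometric_iso\<close> asks for.\<close>

lemma pick_matrix_iff:
  assumes "f \<in> carrier H_infinity" "0 \<le> C"
  shows "positive_semidefinite (pick_matrix l r C (value_tuple l r f)) \<longleftrightarrow>
    (\<exists>g\<in>carrier H_infinity. anorm H_infinity g \<le> C \<and> value_tuple l r g = value_tuple l r f)"
proof -
  have "positive_semidefinite (pick_matrix l r C (value_tuple l r f)) \<longleftrightarrow>
      psd_on {..<Suc r} (\<lambda>i j. ((of_real C)\<^sup>2 - f (l i) * cnj (f (l j))) / (1 - l i * cnj (l j)))"
    unfolding positive_semidefinite_pick_matrix_iff
    by (rule psd_on_cong) (simp only: value_tuple_def index_vec lessThan_iff)
  also have "\<dots> \<longleftrightarrow> (\<exists>g\<in>carrier H_infinity. anorm H_infinity g \<le> C \<and> (\<forall>i\<in>{..<Suc r}. g (l i) = f (l i)))"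
    by (rule H_infinity_Pick[OF assms(2) finite_lessThan inj_on_subset[OF inj subset_UNIV]
          image_subsetI[OF in_disc], symmetric])
  finally show ?thesis unfolding vec_value_tuple_eq_iff .
qed

text \<open>The set \<open>S\<close> of admissible bounds is closed and bounded below, and it
  contains the norm of any interpolating function, so its infimum is admissible. It is upward closed
  because an interpolating function of norm at most \<open>Inf S\<close> also has norm at most any
  larger \<open>C\<close>.\<close>

lemma interpolation_norm_le_iff:
  assumes w: "w \<in> carrier (interpolation_algebra l r)" and C: "0 \<le> C"
  shows "anorm (interpolation_algebra l r) w \<le> C \<longleftrightarrow> positive_semidefinite (pick_matrix l r C w)"
proof -
  obtain f where f: "f \<in> carrier H_infinity" and wf: "w = value_tuple l r f"
    using w by (auto simp: interpolation_algebra_def)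
  define S where "S = {C. 0 \<le> C \<and> positive_semidefinite (pick_matrix l r C w)}"
  have norm: "anorm (interpolation_algebra l r) w = Inf S"
    by (simp add: interpolation_algebra_def S_def)
  have "S = {0..} \<inter> {C. positive_semidefinite (pick_matrix l r C w)}" by (auto simp: S_def)
  then have "closed S" using closed_positive_semidefinite_pick_matrix by (simp add: closed_Int)
  moreover have S_iff: "c \<in> S \<longleftrightarrow> 0 \<le> c \<and>
      (\<exists>g\<in>carrier H_infinity. anorm H_infinity g \<le> c \<and> value_tuple l r g = value_tuple l r f)" for c
    unfolding S_def mem_Collect_eq wf using pick_matrix_iff[OF f, of c r] by blast
  have "anorm H_infinity f \<in> S"
    unfolding S_iff using f H_infinity_norm_nonneg by blast
  moreover have bdd: "bdd_below S" by (rule bdd_belowI[of _ 0]) (simp add: S_def)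
  ultimately have inf: "Inf S \<in> S" by (intro closed_contains_Inf) auto
  show ?thesis
  proof
    assume "positive_semidefinite (pick_matrix l r C w)"
    then show "anorm (interpolation_algebra l r) w \<le> C"
      unfolding norm using C bdd by (intro cInf_lower) (simp_all add: S_def)
  next
    assume le: "anorm (interpolation_algebra l r) w \<le> C"
    obtain g where "g \<in> carrier H_infinity" "anorm H_infinity g \<le> Inf S" "value_tuple l r g = value_tuple l r f"
      using inf unfolding S_iff by blast
    moreover from this(2) have "anorm H_infinity g \<le> C" using le unfolding norm by (rule order_trans)
    ultimately have "\<exists>g\<in>carrier H_infinity. anorm H_infinity g \<le> C \<and> value_tuple l r g = value_tuple l r f"
      by blast
    then show "positive_semidefinite (pick_matrix l r C w)"
      unfolding wf pick_matrix_iff[OF f C] .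
  qed
qed

lemma interpolation_norm_nonneg:
  assumes "w \<in> carrier (interpolation_algebra l r)"
  shows "0 \<le> anorm (interpolation_algebra l r) w"
proof -
  obtain f where f: "f \<in> carrier H_infinity" "w = value_tuple l r f"
    using assms by (auto simp: interpolation_algebra_def)
  have "positive_semidefinite (pick_matrix l r (anorm H_infinity f) w)"
    unfolding f(2) pick_matrix_iff[OF f(1) H_infinity_norm_nonneg[OF f(1)]] using f(1) by blast
  then have "{C. 0 \<le> C \<and> positive_semidefinite (pick_matrix l r C w)} \<noteq> {}"
    using H_infinity_norm_nonneg[OF f(1)] by blast
  then show ?thesis by (simp add: interpolation_algebra_def) (rule cInf_greatest, auto)
qed

text \<open>The family dual to evaluation at the first \<open>Suc r\<close> nodes; distinctness of
  the nodes keeps the denominators nonzero.\<close>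

definition lagrange :: "nat \<Rightarrow> nat \<Rightarrow> complex \<Rightarrow> complex" where
  "lagrange r j = (\<lambda>z\<in>disc. \<Prod>k\<in>{..r} - {j}. (z - l k) / (l j - l k))"

lemma lagrange_eq:
  assumes "i \<le> r" "j \<le> r"
  shows "lagrange r j (l i) = (if i = j then 1 else 0)"
proof (cases "i = j")
  case True
  have "l j - l k \<noteq> 0" if "k \<noteq> j" for k using inj that by (auto simp: inj_def)
  then show ?thesis using True in_disc[of j] by (auto simp: lagrange_def intro!: prod.neutral)
next
  case False
  then have "(\<Prod>k\<in>{..r} - {j}. (l i - l k) / (l j - l k)) = 0"
    using assms by (intro prod_zero) auto
  then show ?thesis using False in_disc[of i] by (simp add: lagrange_def)
qed

lemma vanishing_filtration: "detection_filtration H_infinity (vanishing_ideal l)"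
proof (rule H_infinity_filtration[where \<phi> = "\<lambda>i f. f (l i)" and e = lagrange])
  show "lagrange r j \<in> carrier H_infinity" if "j \<le> r" for r j
  proof -
    have "l j - l k \<noteq> 0" if "k \<in> {..r} - {j}" for k using inj that by (auto simp: inj_def)
    then show ?thesis unfolding lagrange_def
      by (intro H_infinity_entire holomorphic_intros) auto
  qed
  show "cmod (f (l i)) \<le> anorm H_infinity f" if "f \<in> carrier H_infinity" for f i
    using that in_disc by (rule H_infinity_norm_upper)
qed (use in_disc in \<open>auto simp: vanishing_ideal_def H_infinity_closed lagrange_eq\<close>)

lemma interpolation_quotient_iso:
  defines "\<Phi> \<equiv> \<lambda>r X. the_elem (value_tuple l r ` X)"
  shows "\<Phi> r \<in> isometric_iso (quotient_algebra H_infinity (vanishing_ideal l r)) (interpolation_algebra l r)"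
    and "\<And>f. f \<in> carrier H_infinity \<Longrightarrow>
      \<Phi> r (vanishing_ideal l r +>\<^bsub>H_infinity\<^esub> f) = value_tuple l r f"
proof -
  have l: "cmod (l i) < 1" for i using in_disc[of i] by simp
  have surj: "value_tuple l r ` carrier H_infinity = carrier (interpolation_algebra l r)"
    by (simp add: interpolation_algebra_def)
  then have mem: "value_tuple l r f \<in> carrier (interpolation_algebra l r)" if "f \<in> carrier H_infinity" for f
    using that by blast
  have hom: "value_tuple l r \<in> Ring.ring_hom H_infinity (interpolation_algebra l r)"
    by (rule ring_hom_memI) (auto simp: interpolation_algebra_def value_tuple_def l intro!: eq_vecI)
  have smult: "value_tuple l r (c \<odot>\<^bsub>H_infinity\<^esub> f) = c \<odot>\<^bsub>interpolation_algebra l r\<^esub> value_tuple l r f"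
    for c f by (auto simp: interpolation_algebra_def value_tuple_def l intro!: eq_vecI)
  have ker: "value_tuple l r f = value_tuple l r g \<longleftrightarrow> f \<ominus>\<^bsub>H_infinity\<^esub> g \<in> vanishing_ideal l r"
    if fg: "f \<in> carrier H_infinity" "g \<in> carrier H_infinity" for f g
    using H_infinity_closed(3)[OF fg] fg
    by (simp only: vanishing_ideal_def H_infinity_minus vec_value_tuple_eq_iff) (auto simp: l less_Suc_eq_le)
  \<comment> \<open>Positivity of the Pick matrix is the common middle term of the two
    equivalences.\<close>
  have norm: "anorm (interpolation_algebra l r) (value_tuple l r f) \<le> C \<longleftrightarrow>
      (\<exists>g\<in>carrier H_infinity. anorm H_infinity g \<le> C \<and> value_tuple l r g = value_tuple l r f)"
    if "f \<in> carrier H_infinity" "0 \<le> C" for f C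
    using interpolation_norm_le_iff[OF mem[OF that(1)] that(2)] pick_matrix_iff[OF that] by simp
  note iso = quotient_algebra_isometric_iso[OF H_infinity_ring
      detection_filtration.two_sided_ideal[OF vanishing_filtration] _ H_infinity_norm_nonneg
      hom surj smult ker interpolation_norm_nonneg[OF mem] norm]
  show "\<Phi> r \<in> isometric_iso (quotient_algebra H_infinity (vanishing_ideal l r)) (interpolation_algebra l r)"
    unfolding \<Phi>_def by (rule iso(1)) (simp_all add: H_infinity_closed)
  show "\<Phi> r (vanishing_ideal l r +>\<^bsub>H_infinity\<^esub> f) = value_tuple l r f"
    if "f \<in> carrier H_infinity" for f
    unfolding \<Phi>_def by (rule iso(2)) (simp_all add: H_infinity_closed that)
qed

lemma leading_entries_value_tuple:
  "r \<le> s \<Longrightarrow> leading_entries r (value_tuple l s f) = value_tuple l r f"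
  by (auto simp: leading_entries_def value_tuple_def intro!: eq_vecI)

text \<open>The witness is induced by evaluation at the nodes; the connecting maps become
  restriction to initial segments because all tuples come from the same function.\<close>

lemma vanishing_envelope:
  "\<exists>\<Phi>. (\<forall>r. \<Phi> r \<in> isometric_iso (quotient_algebra H_infinity (vanishing_ideal l r))
                  (interpolation_algebra l r) \<and>
          (\<forall>f\<in>carrier H_infinity.
            \<Phi> r (vanishing_ideal l r +>\<^bsub>H_infinity\<^esub> f) = value_tuple l r f)) \<and>
        (\<lambda>a r. \<Phi> r (a r)) \<in>
          isometric_iso (detection_envelope H_infinity (vanishing_ideal l))
            (bounded_limit (interpolation_algebra l) leading_entries)"
  using interpolation_quotient_iso leading_entries_value_tuple
  by (intro exI[of _ "\<lambda>r X. the_elem (value_tuple l r ` X)"] conjI allI ballI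
      detection_envelope_isometric_iso[OF vanishing_filtration, of _ _ "\<lambda>r. value_tuple l r"]) auto

end

text \<open>The witness sends a coset to the Toeplitz matrix of its common Taylor coefficients;
  passing to a smaller index keeps the upper left block, since the entries depend only on the
  coefficients and not on the size.\<close>

lemma taylor_envelope:
  "\<exists>\<Phi>. (\<forall>r. \<Phi> r \<in> isometric_iso (quotient_algebra H_infinity (taylor_ideal r)) (toeplitz_algebra r) \<and>
          (\<forall>f\<in>carrier H_infinity.
            \<Phi> r (taylor_ideal r +>\<^bsub>H_infinity\<^esub> f) = toeplitz r (taylor_coeff f))) \<and>
        (\<lambda>a r. \<Phi> r (a r)) \<in>
          isometric_iso (detection_envelope H_infinity taylor_ideal)
            (bounded_limit toeplitz_algebra leading_block)"
  using toeplitz_quotient_iso leading_block_toeplitz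
  by (intro exI[of _ "\<lambda>r X. the_elem ((\<lambda>f. toeplitz r (taylor_coeff f)) ` X)"] conjI allI ballI
      detection_envelope_isometric_iso[OF taylor_filtration, of _ _ "\<lambda>r f. toeplitz r (taylor_coeff f)"]) auto

theorem corollary10p30:
  shows
    "(detection_filtration H_infinity taylor_ideal \<and>
      (\<exists>\<Phi>.
        (\<forall>r. \<Phi> r \<in> isometric_iso (quotient_algebra H_infinity (taylor_ideal r)) (toeplitz_algebra r) \<and>
          (\<forall>f\<in>carrier H_infinity.
            \<Phi> r (taylor_ideal r +>\<^bsub>H_infinity\<^esub> f) = toeplitz r (taylor_coeff f))) \<and>
        (\<lambda>a r. \<Phi> r (a r)) \<in>
          isometric_iso (detection_envelope H_infinity taylor_ideal)
            (bounded_limit toeplitz_algebra leading_block)))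
     \<and>
     (\<forall>l :: nat \<Rightarrow> complex. range l \<subseteq> disc \<and> inj l \<and> (\<exists>p\<in>disc. p islimpt range l) \<longrightarrow>
      detection_filtration H_infinity (vanishing_ideal l) \<and>
      (\<forall>r. \<forall>w\<in>carrier (interpolation_algebra l r). \<forall>C\<ge>0.
        anorm (interpolation_algebra l r) w \<le> C \<longleftrightarrow> positive_semidefinite (pick_matrix l r C w)) \<and>
      (\<exists>\<Phi>.
        (\<forall>r. \<Phi> r \<in> isometric_iso (quotient_algebra H_infinity (vanishing_ideal l r))
                  (interpolation_algebra l r) \<and>
          (\<forall>f\<in>carrier H_infinity.
            \<Phi> r (vanishing_ideal l r +>\<^bsub>H_infinity\<^esub> f) = value_tuple l r f)) \<and>
        (\<lambda>a r. \<Phi> r (a r)) \<in>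
          isometric_iso (detection_envelope H_infinity (vanishing_ideal l))
            (bounded_limit (interpolation_algebra l) leading_entries)))"
proof (intro conjI allI impI; (elim conjE)?)
  show "detection_filtration H_infinity taylor_ideal" by (rule taylor_filtration)
  fix l :: "nat \<Rightarrow> complex"
  assume "range l \<subseteq> disc" "inj l"
  then interpret interpolation_nodes l by unfold_locales blast+
  show "detection_filtration H_infinity (vanishing_ideal l)" by (rule vanishing_filtration)
  show "\<forall>w\<in>carrier (interpolation_algebra l r). \<forall>C\<ge>0.
      anorm (interpolation_algebra l r) w \<le> C \<longleftrightarrow> positive_semidefinite (pick_matrix l r C w)" for r
    using interpolation_norm_le_iff by blast
qed (rule taylor_envelope, rule interpolation_nodes.vanishing_envelope, unfold_locales, blast+)

end
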